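(* Let $\nu>0$, $K_{\min}\ge 0$, and let $\omega\subset\mathbb{T}^3$ be a measurable set of positive measure with associated nonnegative localization function $\chi_\omega\in L^\infty(\mathbb{T}^3)$. Assume that there exists a constant $C_\omega>0$ such that, for all divergence-free trigonometric polynomials $v\in H$, $$\|v\|_{L^2}^2\le C_\omega\left(\|\chi_\omega^{1/2}v\|_{L^2}^2+\|\nabla v\|_{L^2}^2\right).$$ Then there exists a constant $\alpha_\omega>0$ such that $$\nu\|\nabla v\|_{L^2}^2+K_{\min}\|\chi_\omega^{1/2}v\|_{L^2}^2\ge\alpha_\omega\|v\|_{L^2}^2,\qquad\forall v\in V.$$ More precisely, one may take $\alpha_\omega=C_\omega^{-1}\min(\nu,K_{\min})$, where $C_\omega$ is the constant in the assumed inequality.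
   Context: $\mathbb{T}^3=(\mathbb{R}/\mathbb{Z})^3$. $H:=\{v\in L^2(\mathbb{T}^3;\mathbb{R}^3): \nabla\cdot v=0,\ \int_{\mathbb{T}^3}v\,dx=0\}$ with the $L^2$ norm, and $V:=H^1(\mathbb{T}^3;\mathbb{R}^3)\cap H$. The number $\nu$ is the kinematic viscosity and $K_{\min}$ is a scalar damping gain. The function $\chi_\omega$ is typically the indicator function of $\omega$ or a smooth cutoff supported in $\omega$. A trigonometric polynomial is a (real, vector-valued) finite linear combination of Fourier modes $e^{2\pi i k\cdot x}$, $k\in\mathbb{Z}^3$. *)

theory Defs
  imports "HOL-Analysis.Analysis"
begin

text \<open>
  The torus \<open>(\<real>/\<int>)\<^sup>3\<close> is handled through its universal cover: functions on it are the
  functions on \<open>real^3\<close> that are invariant under integer translations, subsets of it are the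
  sets with invariant membership predicate, and integration is over one period cell. The
  boundary of the cell is a null set, so the closed cube serves as the cell.
\<close>

definition periodic :: "(real^3 \<Rightarrow> 'a) \<Rightarrow> bool" where
  "periodic f \<longleftrightarrow> (\<forall>x k. (\<forall>i. k $ i \<in> \<int>) \<longrightarrow> f (x + k) = f x)"

definition T3 :: "(real^3) measure" where
  "T3 = lebesgue_on (cbox 0 1)"

definition torus_measurable_set :: "(real^3) set \<Rightarrow> bool" where
  "torus_measurable_set A \<longleftrightarrow> periodic (\<lambda>x. x \<in> A) \<and> A \<inter> space T3 \<in> sets T3"

definition torus_emeasure :: "(real^3) set \<Rightarrow> ennreal" where
  "torus_emeasure A = emeasure T3 (A \<inter> space T3)"


text \<open>
  Elements of Lebesgue and Sobolev spaces are represented by functions rather than by classes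
  modulo a.e. equality; all the quantities below only depend on the class.
\<close>

definition L2 :: "(real^3 \<Rightarrow> 'a::euclidean_space) set" where
  "L2 = {f. periodic f \<and> f \<in> borel_measurable T3 \<and> integrable T3 (\<lambda>x. (norm (f x))\<^sup>2)}"

definition L2norm :: "(real^3 \<Rightarrow> 'a::euclidean_space) \<Rightarrow> real" where
  "L2norm f = sqrt (\<integral>x. (norm (f x))\<^sup>2 \<partial>T3)"

definition Linfty :: "(real^3 \<Rightarrow> real) set" where
  "Linfty = {f. periodic f \<and> f \<in> borel_measurable T3 \<and> (\<exists>M. AE x in T3. \<bar>f x\<bar> \<le> M)}"


definition partial_deriv :: "3 \<Rightarrow> (real^3 \<Rightarrow> real) \<Rightarrow> real^3 \<Rightarrow> real" where
  "partial_deriv i f x = frechet_derivative f (at x) (axis i 1)"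

primrec C_k :: "nat \<Rightarrow> (real^3 \<Rightarrow> real) \<Rightarrow> bool" where
  "C_k 0 f \<longleftrightarrow> continuous_on UNIV f"
| "C_k (Suc n) f \<longleftrightarrow> (\<forall>x. f differentiable (at x)) \<and> (\<forall>i. C_k n (partial_deriv i f))"

definition test_functions :: "(real^3 \<Rightarrow> real) set" where
  "test_functions = {\<phi>. periodic \<phi> \<and> (\<forall>n. C_k n \<phi>)}"

definition div_free :: "(real^3 \<Rightarrow> real^3) \<Rightarrow> bool" where
  "div_free v \<longleftrightarrow>
    (\<forall>\<phi>\<in>test_functions. (\<integral>x. (\<Sum>i\<in>UNIV. v x $ i * partial_deriv i \<phi> x) \<partial>T3) = 0)"

text \<open>
  The entry \<open>G x $ j $ i\<close> is the \<open>i\<close>-th weak partial derivative of the \<open>j\<close>-th component. The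
  norm of \<open>real^3^3\<close> is the Frobenius norm, so that \<open>(L2norm G)\<^sup>2\<close> is the sum of the squared
  norms of all nine derivatives.
\<close>

definition is_weak_gradient :: "(real^3 \<Rightarrow> real^3) \<Rightarrow> (real^3 \<Rightarrow> real^3^3) \<Rightarrow> bool" where
  "is_weak_gradient v G \<longleftrightarrow> G \<in> L2 \<and>
    (\<forall>\<phi>\<in>test_functions. \<forall>i j.
      (\<integral>x. v x $ j * partial_deriv i \<phi> x \<partial>T3) = - (\<integral>x. G x $ j $ i * \<phi> x \<partial>T3))"

text \<open>
  A weak gradient is unique up to a.e. equality; the choice below picks a representative.
\<close>

definition weak_gradient :: "(real^3 \<Rightarrow> real^3) \<Rightarrow> real^3 \<Rightarrow> real^3^3" where
  "weak_gradient v = (SOME G. is_weak_gradient v G)"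

definition H1 :: "(real^3 \<Rightarrow> real^3) set" where
  "H1 = {v \<in> L2. \<exists>G. is_weak_gradient v G}"

definition H_space :: "(real^3 \<Rightarrow> real^3) set" where
  "H_space = {v \<in> L2. div_free v \<and> (\<integral>x. v x \<partial>T3) = 0}"

definition V_space :: "(real^3 \<Rightarrow> real^3) set" where
  "V_space = H1 \<inter> H_space"


definition fourier_mode :: "int^3 \<Rightarrow> real^3 \<Rightarrow> complex" where
  "fourier_mode k x =
    exp (2 * complex_of_real pi * \<i> * complex_of_real (\<Sum>i\<in>UNIV. real_of_int (k $ i) * x $ i))"

text \<open>
  The coefficients are complex vectors, the resulting field is required to be real.
\<close>

definition trig_poly :: "(real^3 \<Rightarrow> real^3) \<Rightarrow> bool" where
  "trig_poly v \<longleftrightarrow>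
    (\<exists>(K :: (int^3) set) (c :: int^3 \<Rightarrow> complex^3). finite K \<and>
      (\<forall>x j. complex_of_real (v x $ j) = (\<Sum>k\<in>K. c k $ j * fourier_mode k x)))"

end

theory Submission
  imports Defs
begin

text \<open>
  For \<open>v\<close> in \<open>V\<close> and a finite set \<open>K\<close> of frequencies with \<open>K = -K\<close>, let \<open>S v\<close> be the Fourier projection
  of \<open>v\<close> onto \<open>K\<close>. It is a real trigonometric polynomial, and testing the weak formulations with the
  modes shows that it is again divergence free of mean zero and that its gradient is \<open>S (\<nabla>v)\<close>. Hence
  the assumed inequality applies to \<open>S v\<close>, and Bessel's inequality bounds \<open>\<parallel>\<nabla>S v\<parallel>\<close> by \<open>\<parallel>\<nabla>v\<parallel>\<close>. By density of
  trigonometric polynomials in \<open>L\<^sup>2\<close>, \<open>S v\<close> tends to \<open>v\<close> as \<open>K\<close> grows, and since \<open>\<chi>_\<omega>\<close> is bounded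
  the inequality passes to \<open>v\<close>. As \<open>v\<close> has mean zero, comparing Fourier coefficients also gives the
  Poincare inequality \<open>\<parallel>v\<parallel> \<le> \<parallel>\<nabla>v\<parallel>\<close>, so that \<open>\<alpha>_\<omega> = \<nu>\<close> is admissible even when \<open>K_min = 0\<close>.
\<close>

section \<open>Integration over the torus\<close>

lemma space_T3 [simp]: "space T3 = cbox 0 1"
  by (simp add: T3_def)

lemma finite_measure_T3: "finite_measure T3"
  unfolding T3_def by (rule finite_measure_lebesgue_on) simp

lemma measure_T3 [simp]: "measure T3 (cbox 0 1) = 1"
proof -
  have "measure T3 (cbox 0 1) = measure lborel (cbox (0::real^3) 1)"
    by (simp add: T3_def measure_restrict_space)
  also have "\<dots> = 1"
    by (subst content_cbox_cart) (auto simp: interval_eq_empty_cart)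
  finally show ?thesis .
qed

lemma continuous_imp_integrable_T3:
  fixes f :: "real^3 \<Rightarrow> 'a::euclidean_space"
  assumes "continuous_on UNIV f"
  shows "integrable T3 f"
  unfolding T3_def by (rule continuous_imp_integrable) (rule continuous_on_subset[OF assms], simp)

lemma continuous_imp_borel_measurable_T3:
  fixes f :: "real^3 \<Rightarrow> 'a::euclidean_space"
  shows "continuous_on UNIV f \<Longrightarrow> f \<in> borel_measurable T3"
  by (rule borel_measurable_integrable[OF continuous_imp_integrable_T3])

section \<open>Translation invariance of the integral and vanishing integrals of periodic
  derivatives\<close>

lemma integral_T3_eq:
  fixes f :: "real^3 \<Rightarrow> real"
  assumes "continuous_on UNIV f"
  shows "integral\<^sup>L T3 f = integral (cbox 0 1) f"
  using continuous_imp_integrable_T3[OF assms] unfolding T3_def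
  by (rule lebesgue_integral_eq_integral) simp

text \<open>The shifted cell is cut by the plane where coordinate i equals 1. By periodicity the
  slab beyond that plane may be moved back by one period, and the two slabs reassemble the unit
  cell.\<close>

lemma integral_T3_shift:
  fixes f :: "real^3 \<Rightarrow> real"
  assumes per: "periodic f" and cont: "continuous_on UNIV f" and t: "0 \<le> t" "t \<le> 1"
  shows "(\<integral>x. f (x + t *\<^sub>R axis i 1) \<partial>T3) = integral\<^sup>L T3 f"
proof -
  let ?e = "axis i 1 :: real^3" and ?c = "t *\<^sub>R axis i 1 :: real^3"
  have axis_inner: "x \<bullet> axis i 1 = x $ i" for x :: "real^3"
    by (simp add: inner_axis)
  have axis_nth: "axis l 1 $ j = (if j = l then 1 else 0 :: real)" for l j :: 3
    by (simp add: axis_def)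
  have int: "f integrable_on cbox a b" for a b
    by (rule integrable_continuous) (rule continuous_on_subset[OF cont], simp)
  have e: "?e \<in> Basis" by (simp add: axis_in_Basis_iff)
  have cts: "continuous_on UNIV (\<lambda>x. f (x + ?c))"
    by (rule continuous_on_compose2[OF cont]) (auto intro!: continuous_intros)
  have fe: "f (x + ?e) = f x" for x
    using per unfolding periodic_def by (auto simp: axis_def)
  have "(\<integral>x. f (x + ?c) \<partial>T3) = integral (cbox 0 1) (\<lambda>x. f (x + ?c))"
    by (rule integral_T3_eq[OF cts])
  also have "\<dots> = integral (cbox ?c (1 + ?c)) f"
    using integral_shift_cbox[of ?c ?c "1 + ?c" f] by simp
  also have "\<dots> = integral (cbox ?c (1 + ?c) \<inter> {x. x \<bullet> ?e \<le> 1}) f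
                 + integral (cbox ?c (1 + ?c) \<inter> {x. x \<bullet> ?e \<ge> 1}) f"
    by (rule integral_split[OF int e])
  also have "cbox ?c (1 + ?c) \<inter> {x. x \<bullet> ?e \<le> 1} = cbox ?c 1"
    using t exhaust_3[of i] by (auto simp: mem_box_cart forall_3 axis_inner axis_nth)
  also have "cbox ?c (1 + ?c) \<inter> {x. x \<bullet> ?e \<ge> 1} = cbox ?e (1 + ?c)"
    using t exhaust_3[of i] by (auto simp: mem_box_cart forall_3 axis_inner axis_nth)
  also have "integral (cbox ?e (1 + ?c)) f = integral (cbox (?e - ?e) (1 + ?c - ?e)) (\<lambda>x. f (x + ?e))"
    by (rule integral_shift_cbox[symmetric])
  also have "cbox (?e - ?e) (1 + ?c - ?e) = cbox 0 1 \<inter> {x. x \<bullet> ?e \<le> t}"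
    using t exhaust_3[of i] by (auto simp: mem_box_cart forall_3 axis_inner axis_nth)
  also have "cbox ?c 1 = cbox 0 1 \<inter> {x. x \<bullet> ?e \<ge> t}"
    using t exhaust_3[of i] by (auto simp: mem_box_cart forall_3 axis_inner axis_nth)
  finally have "(\<integral>x. f (x + ?c) \<partial>T3) = integral (cbox 0 1 \<inter> {x. x \<bullet> ?e \<ge> t}) f 
      + integral (cbox 0 1 \<inter> {x. x \<bullet> ?e \<le> t}) f"
    by (simp only: fe)
  also have "\<dots> = integral (cbox 0 1) f"
    by (subst integral_split[OF int e, of 0 1 t]) simp
  also have "\<dots> = integral\<^sup>L T3 f" by (rule integral_T3_eq[OF cont, symmetric])
  finally show ?thesis .
qed

lemma has_real_derivative_along_axis:
  assumes "f differentiable at (x + s *\<^sub>R axis i 1)"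
  shows "((\<lambda>t. f (x + t *\<^sub>R axis i 1)) has_real_derivative partial_deriv i f (x + s *\<^sub>R axis i 1)) (at s)"
proof -
  let ?D = "frechet_derivative f (at (x + s *\<^sub>R axis i 1))"
  have D: "(f has_derivative ?D) (at (x + s *\<^sub>R axis i 1))"
    using assms frechet_derivative_works by blast
  have "((\<lambda>t. f (x + t *\<^sub>R axis i 1)) has_derivative (\<lambda>t. ?D (t *\<^sub>R axis i 1))) (at s)"
    by (rule has_derivative_compose[where f = "\<lambda>t. x + t *\<^sub>R axis i 1" and g = f, OF _ D])
      (auto intro!: derivative_eq_intros)
  moreover have "?D (t *\<^sub>R axis i 1) = partial_deriv i f (x + s *\<^sub>R axis i 1) * t" for t
    using linear_scale[OF has_derivative_linear[OF D]] by (simp add: partial_deriv_def)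
  ultimately show ?thesis by (simp add: has_field_derivative_def)
qed

text \<open>The difference quotients in direction i have integral zero by translation invariance,
  and dominated convergence passes this on to their limit.\<close>

lemma integral_partial_deriv_periodic:
  assumes per: "periodic f" and diff: "\<And>x. f differentiable at x"
    and cont': "continuous_on UNIV (partial_deriv i f)"
  shows "(\<integral>x. partial_deriv i f x \<partial>T3) = 0"
proof -
  let ?e = "axis i 1 :: real^3"
  have cont: "continuous_on UNIV f"
    by (simp add: continuous_at_imp_continuous_on diff differentiable_imp_continuous_within)
  \<comment> \<open>The segments from x to \<open>x + t n *\<^sub>R ?e\<close> may leave the unit
    cell but stay in the cube of side 2, so the dominating constant is taken there.\<close>
  have "bounded (partial_deriv i f ` cbox 0 2)"
    by (intro compact_imp_bounded compact_continuous_image continuous_on_subset[OF cont']) auto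
  then obtain B where B: "\<And>x. x \<in> cbox 0 2 \<Longrightarrow> \<bar>partial_deriv i f x\<bar> \<le> B"
    by (auto simp: bounded_iff)
  define t where "t n = 1 / real (Suc n)" for n
  have t: "0 < t n" "t n \<le> 1" for n by (auto simp: t_def divide_simps)
  have tlim: "t \<longlonglongrightarrow> 0" unfolding t_def using LIMSEQ_inverse_real_of_nat by (simp add: inverse_eq_divide)
  define s where "s n x = (f (x + t n *\<^sub>R ?e) - f x) / t n" for n x
  have cs: "continuous_on UNIV (\<lambda>x. f (x + t n *\<^sub>R ?e))" for n
    by (rule continuous_on_compose2[OF cont]) (auto intro!: continuous_intros)
  have s0: "integral\<^sup>L T3 (s n) = 0" for n
    unfolding s_def using integral_T3_shift[OF per cont, of "t n" i] t[of n]
      continuous_imp_integrable_T3[OF cont] continuous_imp_integrable_T3[OF cs[of n]]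
    by (simp add: less_imp_le)
  have "(\<lambda>n. integral\<^sup>L T3 (s n)) \<longlonglongrightarrow> integral\<^sup>L T3 (partial_deriv i f)"
  proof (rule integral_dominated_convergence[where w = "\<lambda>_. B"])
    show "partial_deriv i f \<in> borel_measurable T3" by (rule continuous_imp_borel_measurable_T3[OF cont'])
    show "s n \<in> borel_measurable T3" for n
      unfolding s_def using continuous_imp_borel_measurable_T3[OF cont] continuous_imp_borel_measurable_T3[OF cs[of n]]
      by simp
    show "integrable T3 (\<lambda>_. B)" by (rule continuous_imp_integrable_T3) auto
    show "AE x in T3. (\<lambda>n. s n x) \<longlonglongrightarrow> partial_deriv i f x"
    proof (rule AE_I2)
      fix x
      have "((\<lambda>h. (f (x + (0 + h) *\<^sub>R ?e) - f (x + 0 *\<^sub>R ?e)) / h) \<longlongrightarrow> partial_deriv i f (x + 0 *\<^sub>R ?e)) (at 0)"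
        by (rule has_real_derivative_along_axis[OF diff, unfolded DERIV_def])
      then have "((\<lambda>h. (f (x + h *\<^sub>R ?e) - f x) / h) \<longlongrightarrow> partial_deriv i f x) (at 0)" by simp
      moreover have "filterlim t (at 0) sequentially"
        unfolding filterlim_at using tlim by (simp add: less_imp_neq[OF t(1), symmetric])
      ultimately show "(\<lambda>n. s n x) \<longlonglongrightarrow> partial_deriv i f x"
        unfolding s_def by (rule filterlim_compose)
    qed
    show "AE x in T3. norm (s n x) \<le> B" for n
    proof (rule AE_I2)
      fix x assume x: "x \<in> space T3"
      obtain z where z: "0 < z" "z < t n" "f (x + t n *\<^sub>R ?e) - f (x + 0 *\<^sub>R ?e) = (t n - 0) * partial_deriv i f (x + z *\<^sub>R ?e)"
        using MVT2[OF t(1)[of n], of "\<lambda>s. f (x + s *\<^sub>R ?e)" "\<lambda>s. partial_deriv i f (x + s *\<^sub>R ?e)",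
            OF has_real_derivative_along_axis[OF diff]] by metis
      have "x + z *\<^sub>R ?e \<in> cbox 0 2"
        using x z(1,2) t(2)[of n] exhaust_3[of i] by (auto simp: mem_box_cart forall_3 axis_def)
      then show "norm (s n x) \<le> B" using B z t(1)[of n] by (simp add: s_def)
    qed
  qed
  then show ?thesis using s0 by (simp add: LIMSEQ_const_iff)
qed

section \<open>Real Fourier modes, their derivatives and their orthogonality\<close>

text \<open>\<open>fourier_mode k\<close> is the exponential of i times this. Cosine and sine modes
  keep the analysis over the reals; complex numbers enter only in the comparison with
  \<open>trig_poly\<close>.\<close>

definition phase :: "int^3 \<Rightarrow> real^3 \<Rightarrow> real" where
  "phase k x = 2 * pi * (\<Sum>i\<in>UNIV. real_of_int (k $ i) * x $ i)"

abbreviation cosm :: "int^3 \<Rightarrow> real^3 \<Rightarrow> real" where "cosm k x \<equiv> cos (phase k x)"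
abbreviation sinm :: "int^3 \<Rightarrow> real^3 \<Rightarrow> real" where "sinm k x \<equiv> sin (phase k x)"

lemma phase_add: "phase (k + l) x = phase k x + phase l x"
  by (simp add: phase_def algebra_simps sum.distrib)

lemma phase_diff: "phase (k - l) x = phase k x - phase l x"
  by (simp add: phase_def algebra_simps sum_subtractf)

lemma phase_minus: "phase (- k) x = - phase k x"
  by (simp add: phase_def sum_negf)

lemma phase_0 [simp]: "phase 0 x = 0"
  by (simp add: phase_def)

lemma phase_add_int:
  assumes "\<And>i. m $ i \<in> \<int>"
  obtains n :: int where "phase k (x + m) = phase k x + 2 * pi * real_of_int n"
proof -
  have "(\<Sum>i\<in>UNIV. real_of_int (k $ i) * m $ i) \<in> \<int>"
    using assms by (intro Ints_sum Ints_mult) auto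
  then obtain n where "(\<Sum>i\<in>UNIV. real_of_int (k $ i) * m $ i) = real_of_int n"
    by (auto elim: Ints_cases)
  then have "phase k (x + m) = phase k x + 2 * pi * real_of_int n"
    by (simp add: phase_def distrib_left sum.distrib)
  then show ?thesis using that by blast
qed

lemma sin_cos_add_int: "sin (a + 2 * pi * real_of_int n) = sin a" "cos (a + 2 * pi * real_of_int n) = cos a"
  by (simp_all add: sin_add cos_add)

lemma periodic_trig: "periodic (\<lambda>x. a * cosm k x + b * sinm k x)"
  unfolding periodic_def
proof (intro allI impI)
  fix x m :: "real^3" assume "\<forall>i. m $ i \<in> \<int>"
  then obtain n where "phase k (x + m) = phase k x + 2 * pi * real_of_int n"
    using phase_add_int[of m k x] by blast
  then show "a * cosm k (x + m) + b * sinm k (x + m) = a * cosm k x + b * sinm k x"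
    by (simp add: sin_cos_add_int)
qed

text \<open>The phase is linear in x, hence its own derivative at every point.\<close>

lemma has_derivative_phase [derivative_intros]:
  "(phase k has_derivative phase k) (at x within S)"
  unfolding phase_def[abs_def] 
  by (auto intro!: derivative_eq_intros bounded_linear_imp_has_derivative[OF bounded_linear_vec_nth])

lemma phase_axis [simp]: "phase k (axis i 1) = 2 * pi * real_of_int (k $ i)"
proof -
  have "(\<Sum>j\<in>UNIV. real_of_int (k $ j) * axis i 1 $ j) = (\<Sum>j\<in>UNIV. if j = i then real_of_int (k $ j) else 0)"
    by (rule sum.cong) (auto simp: axis_def)
  then show ?thesis by (simp add: phase_def)
qed

lemma has_derivative_trig:
  "((\<lambda>x. a * cosm k x + b * sinm k x) has_derivative
     (\<lambda>h. (b * cosm k x - a * sinm k x) * phase k h)) (at x)"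
  by (auto intro!: derivative_eq_intros simp: algebra_simps)

lemma differentiable_trig: "(\<lambda>x. a * cosm k x + b * sinm k x) differentiable (at x)"
  using has_derivative_trig differentiable_def by blast

lemma partial_deriv_trig:
  "partial_deriv i (\<lambda>x. a * cosm k x + b * sinm k x) =
     (\<lambda>x. (2 * pi * real_of_int (k $ i) * b) * cosm k x + (- (2 * pi * real_of_int (k $ i) * a)) * sinm k x)"
  unfolding partial_deriv_def frechet_derivative_at[OF has_derivative_trig, symmetric]
  by (auto simp: algebra_simps)

lemma continuous_phase [continuous_intros]: "continuous_on S (phase k)"
  by (rule has_derivative_continuous_on[OF has_derivative_phase])

text \<open>For fixed k the span of cosine and sine is closed under partial derivatives, so the
  induction leaves the coefficients free.\<close>

lemma C_k_trig: "C_k n (\<lambda>x. a * cosm k x + b * sinm k x)"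
proof (induction n arbitrary: a b)
  case 0
  show ?case by (auto intro!: continuous_intros)
next
  case (Suc n)
  then show ?case by (simp only: C_k.simps partial_deriv_trig differentiable_trig) simp
qed

lemma trig_test_function: "(\<lambda>x. a * cosm k x + b * sinm k x) \<in> test_functions"
  unfolding test_functions_def using periodic_trig C_k_trig by blast

lemma test_functionD:
  assumes "\<phi> \<in> test_functions"
  shows "periodic \<phi>" "\<phi> differentiable (at x)" "continuous_on UNIV \<phi>"
    "continuous_on UNIV (partial_deriv i \<phi>)"
proof -
  have "C_k 0 \<phi>" "C_k (Suc 0) \<phi>" using assms unfolding test_functions_def by blast+
  then show "\<phi> differentiable (at x)" "continuous_on UNIV \<phi>"
    "continuous_on UNIV (partial_deriv i \<phi>)" by simp_all
  show "periodic \<phi>" using assms unfolding test_functions_def by blast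
qed

lemma partial_deriv_mult:
  assumes "f differentiable (at x)" "g differentiable (at x)"
  shows "partial_deriv i (\<lambda>x. f x * g x) x = f x * partial_deriv i g x + partial_deriv i f x * g x"
  unfolding partial_deriv_def
  using frechet_derivative_at[OF has_derivative_mult[OF assms[unfolded frechet_derivative_works]], symmetric]
  by simp

text \<open>The product is periodic, so its derivative integrates to zero and the product rule
  leaves no boundary term.\<close>

lemma integration_by_parts_T3:
  assumes f: "f \<in> test_functions" and g: "g \<in> test_functions"
  shows "(\<integral>x. f x * partial_deriv i g x \<partial>T3) = - (\<integral>x. partial_deriv i f x * g x \<partial>T3)"
proof -
  note F = test_functionD[OF f] and G = test_functionD[OF g]
  have eq: "partial_deriv i (\<lambda>x. f x * g x) = (\<lambda>x. f x * partial_deriv i g x + partial_deriv i f x * g x)"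
    using partial_deriv_mult F(2) G(2) by blast
  have c: "continuous_on UNIV (\<lambda>x. f x * partial_deriv i g x)" "continuous_on UNIV (\<lambda>x. partial_deriv i f x * g x)"
    using F(3,4) G(3,4) by (auto intro!: continuous_intros)
  have "(\<integral>x. partial_deriv i (\<lambda>x. f x * g x) x \<partial>T3) = 0"
  proof (rule integral_partial_deriv_periodic)
    show "periodic (\<lambda>x. f x * g x)" using F(1) G(1) by (auto simp: periodic_def)
    show "(\<lambda>x. f x * g x) differentiable at x" for x using F(2) G(2) by (rule differentiable_mult)
    show "continuous_on UNIV (partial_deriv i (\<lambda>x. f x * g x))" 
      unfolding eq using c by (rule continuous_on_add)
  qed
  then show ?thesis
    unfolding eq using continuous_imp_integrable_T3[OF c(1)] continuous_imp_integrable_T3[OF c(2)] by simp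
qed

text \<open>If \<open>k $ i\<close> is nonzero, each of the two modes is a multiple of the i-th
  derivative of the other.\<close>

lemma integral_trig_nonzero:
  assumes "k \<noteq> 0"
  shows "integral\<^sup>L T3 (cosm k) = 0" "integral\<^sup>L T3 (sinm k) = 0"
proof -
  obtain i where i: "k $ i \<noteq> 0" using assms by (auto simp: vec_eq_iff)
  have *: "(\<integral>x. 2 * pi * real_of_int (k $ i) * b * cosm k x + (- (2 * pi * real_of_int (k $ i) * a)) * sinm k x \<partial>T3) = 0" for a b
    by (rule integral_partial_deriv_periodic[OF periodic_trig[of a k b] differentiable_trig, of i,
          unfolded partial_deriv_trig]) (intro continuous_intros)
  show "integral\<^sup>L T3 (cosm k) = 0" using *[of 1 0] i by simp
  show "integral\<^sup>L T3 (sinm k) = 0" using *[of 0 1] i by simp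
qed

lemma integral_trig:
  "integral\<^sup>L T3 (cosm k) = (if k = 0 then 1 else 0)" "integral\<^sup>L T3 (sinm k) = 0"
  using integral_trig_nonzero[of k] by (cases "k = 0"; simp)+

lemma integrable_trig [simp]: "integrable T3 (cosm k)" "integrable T3 (sinm k)"
  by (rule continuous_imp_integrable_T3, auto intro!: continuous_intros)+

text \<open>Product-to-sum formulas leave only integrals of single modes. The second indicator is
  there because \<open>l\<close> and \<open>- l\<close> give the same real modes up to sign; for k =
  l = 0 both indicators are 1, which gives the correct values 1 for the cosines and 0 for the
  sines.\<close>

lemma orthogonality:
  "(\<integral>x. cosm k x * cosm l x \<partial>T3) = ((if k = l then 1 else 0) + (if k = - l then 1 else 0)) / 2"
  "(\<integral>x. sinm k x * sinm l x \<partial>T3) = ((if k = l then 1 else 0) - (if k = - l then 1 else 0)) / 2"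
  "(\<integral>x. cosm k x * sinm l x \<partial>T3) = 0"
  "(\<integral>x. sinm k x * cosm l x \<partial>T3) = 0"
proof -
  have eqs: "cosm k x * cosm l x = (cosm (k - l) x + cosm (k + l) x) / 2"
    "sinm k x * sinm l x = (cosm (k - l) x - cosm (k + l) x) / 2"
    "cosm k x * sinm l x = (sinm (k + l) x - sinm (k - l) x) / 2"
    "sinm k x * cosm l x = (sinm (k + l) x + sinm (k - l) x) / 2" for x
    by (simp_all add: phase_add phase_diff cos_add cos_diff sin_add sin_diff)
  show
  "(\<integral>x. cosm k x * cosm l x \<partial>T3) = ((if k = l then 1 else 0) + (if k = - l then 1 else 0)) / 2"
  "(\<integral>x. sinm k x * sinm l x \<partial>T3) = ((if k = l then 1 else 0) - (if k = - l then 1 else 0)) / 2"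
  "(\<integral>x. cosm k x * sinm l x \<partial>T3) = 0"
  "(\<integral>x. sinm k x * cosm l x \<partial>T3) = 0"
    unfolding eqs by (simp_all add: integral_trig eq_neg_iff_add_eq_0)
qed

section \<open>Density of trigonometric polynomials in \<open>L\<^sup>2\<close>\<close>

text \<open>Unlike in \<open>L2\<close>, periodicity is not asked for, so that indicators of subsets
  of the cell qualify.\<close>

definition sq_int :: "(real^3 \<Rightarrow> real) \<Rightarrow> bool" where
  "sq_int f \<longleftrightarrow> f \<in> borel_measurable T3 \<and> integrable T3 (\<lambda>x. (f x)\<^sup>2)"

lemma sq_int_measurable: "sq_int f \<Longrightarrow> f \<in> borel_measurable T3"
  and sq_int_integrable: "sq_int f \<Longrightarrow> integrable T3 (\<lambda>x. (f x)\<^sup>2)"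
  by (simp_all add: sq_int_def)

lemma sq_int_mult_integrable:
  assumes f: "sq_int f" and g: "sq_int g"
  shows "integrable T3 (\<lambda>x. f x * g x)"
proof (rule Bochner_Integration.integrable_bound)
  show "integrable T3 (\<lambda>x. (f x)\<^sup>2 + (g x)\<^sup>2)"
    using f g by (simp add: sq_int_def)
  show "(\<lambda>x. f x * g x) \<in> borel_measurable T3"
    using sq_int_measurable[OF f] sq_int_measurable[OF g] by simp
  have "\<bar>a * b\<bar> \<le> a\<^sup>2 + b\<^sup>2" for a b :: real
  proof -
    have "0 \<le> \<bar>a\<bar> * \<bar>b\<bar>" by simp
    moreover have "2 * (\<bar>a\<bar> * \<bar>b\<bar>) \<le> a\<^sup>2 + b\<^sup>2" using sum_squares_bound[of "\<bar>a\<bar>" "\<bar>b\<bar>"] by simp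
    ultimately show ?thesis unfolding abs_mult by linarith
  qed
  then show "AE x in T3. norm (f x * g x) \<le> norm ((f x)\<^sup>2 + (g x)\<^sup>2)" by simp
qed

lemma sq_int_continuous: "continuous_on UNIV f \<Longrightarrow> sq_int f"
  unfolding sq_int_def
  by (intro conjI continuous_imp_borel_measurable_T3 continuous_imp_integrable_T3 continuous_intros)

lemma sq_int_add:
  assumes f: "sq_int f" and g: "sq_int g"
  shows "sq_int (\<lambda>x. f x + g x)"
proof -
  have "integrable T3 (\<lambda>x. (f x)\<^sup>2 + 2 * (f x * g x) + (g x)\<^sup>2)"
    using f g sq_int_mult_integrable[OF f g] by (simp add: sq_int_def)
  then show ?thesis
    using sq_int_measurable[OF f] sq_int_measurable[OF g] by (simp add: sq_int_def power2_sum algebra_simps)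
qed

lemma sq_int_cmult:
  assumes f: "sq_int f" shows "sq_int (\<lambda>x. c * f x)"
  unfolding sq_int_def power_mult_distrib
  using sq_int_measurable[OF f] sq_int_integrable[OF f] by simp

lemma sq_int_diff:
  assumes "sq_int f" "sq_int g" shows "sq_int (\<lambda>x. f x - g x)"
  using sq_int_add[OF assms(1) sq_int_cmult[OF assms(2), of "-1"]] by simp

text \<open>Comes from 2ab \<le> a^2 + b^2. The factor 2 is why approximations are later taken to
  within e / 4.\<close>

lemma integral_sq_triangle:
  assumes f: "sq_int f" and g: "sq_int g"
  shows "(\<integral>x. (f x + g x)\<^sup>2 \<partial>T3) \<le> 2 * (\<integral>x. (f x)\<^sup>2 \<partial>T3) + 2 * (\<integral>x. (g x)\<^sup>2 \<partial>T3)"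
proof -
  have "(\<integral>x. (f x + g x)\<^sup>2 \<partial>T3) \<le> (\<integral>x. 2 * (f x)\<^sup>2 + 2 * (g x)\<^sup>2 \<partial>T3)"
  proof (rule integral_mono)
    show "integrable T3 (\<lambda>x. (f x + g x)\<^sup>2)" using sq_int_add[OF f g] by (rule sq_int_integrable)
    show "integrable T3 (\<lambda>x. 2 * (f x)\<^sup>2 + 2 * (g x)\<^sup>2)" using f g by (simp add: sq_int_def)
    show "(f x + g x)\<^sup>2 \<le> 2 * (f x)\<^sup>2 + 2 * (g x)\<^sup>2" for x
      using sum_squares_bound[of "f x" "g x"] by (simp add: power2_sum)
  qed
  then show ?thesis using f g by (simp add: sq_int_def)
qed

section \<open>The algebra of real trigonometric polynomials\<close>

text \<open>Frequencies may repeat and no normal form is imposed: closure under sums is built in,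
  and the other closure properties follow by induction.\<close>

inductive trig_sum :: "(real^3 \<Rightarrow> real) \<Rightarrow> bool" where
  trig_sum_base: "trig_sum (\<lambda>x. a * cosm k x + b * sinm k x)"
| trig_sum_add: "trig_sum p \<Longrightarrow> trig_sum q \<Longrightarrow> trig_sum (\<lambda>x. p x + q x)"

lemma trig_sum_continuous: "trig_sum p \<Longrightarrow> continuous_on UNIV p"
  by (induction rule: trig_sum.induct) (auto intro!: continuous_intros)

lemma trig_sum_sq_int: "trig_sum p \<Longrightarrow> sq_int p"
  by (intro sq_int_continuous trig_sum_continuous)

lemma trig_sum_const: "trig_sum (\<lambda>x. c)"
  using trig_sum_base[of c 0 0] by simp

lemma trig_sum_cmult: "trig_sum p \<Longrightarrow> trig_sum (\<lambda>x. c * p x)"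
proof (induction rule: trig_sum.induct)
  case (trig_sum_base a k b)
  show ?case using trig_sum.trig_sum_base[of "c * a" k "c * b"] by (simp add: algebra_simps)
next
  case (trig_sum_add p q)
  show ?case using trig_sum.trig_sum_add[OF trig_sum_add.IH] by (simp add: algebra_simps)
qed

lemma trig_sum_sum: "finite A \<Longrightarrow> (\<And>i. i \<in> A \<Longrightarrow> trig_sum (p i)) \<Longrightarrow> trig_sum (\<lambda>x. \<Sum>i\<in>A. p i x)"
  by (induction A rule: finite_induct) (simp_all add: trig_sum_const trig_sum_add)

lemma trig_sum_base_mult:
  "trig_sum (\<lambda>x. (a * cosm k x + b * sinm k x) * (c * cosm l x + d * sinm l x))"
proof -
  have "trig_sum (\<lambda>x. ((a * c + b * d) / 2 * cosm (k - l) x + (b * c - a * d) / 2 * sinm (k - l) x)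
     + ((a * c - b * d) / 2 * cosm (k + l) x + (b * c + a * d) / 2 * sinm (k + l) x))"
    by (intro trig_sum.intros)
  also have "(\<lambda>x. ((a * c + b * d) / 2 * cosm (k - l) x + (b * c - a * d) / 2 * sinm (k - l) x)
     + ((a * c - b * d) / 2 * cosm (k + l) x + (b * c + a * d) / 2 * sinm (k + l) x))
     = (\<lambda>x. (a * cosm k x + b * sinm k x) * (c * cosm l x + d * sinm l x))"
    by (rule ext) (simp add: phase_add phase_diff cos_add cos_diff sin_add sin_diff field_simps)
  finally show ?thesis .
qed

lemma trig_sum_mult: "trig_sum p \<Longrightarrow> trig_sum q \<Longrightarrow> trig_sum (\<lambda>x. p x * q x)"
proof (induction arbitrary: q rule: trig_sum.induct)
  case (trig_sum_base a k b)
  show ?case using trig_sum_base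
  proof (induction rule: trig_sum.induct)
    case (trig_sum_base c l d)
    show ?case by (rule trig_sum_base_mult)
  next
    case (trig_sum_add p q)
    show ?case using trig_sum.trig_sum_add[OF trig_sum_add.IH] by (simp add: algebra_simps)
  qed
next
  case (trig_sum_add p p')
  show ?case using trig_sum.trig_sum_add[OF trig_sum_add.IH[OF trig_sum_add.prems]]
    by (simp add: algebra_simps)
qed

section \<open>The torus as a product of circles\<close>

text \<open>Realizes the torus as a product of three circles in a six-dimensional space, on which
  ordinary polynomials restrict to trigonometric ones.\<close>

definition torus_embed :: "real^3 \<Rightarrow> (real^3) \<times> (real^3)" where
  "torus_embed x = ((\<chi> i. cos (2 * pi * x $ i)), (\<chi> i. sin (2 * pi * x $ i)))"

lemma continuous_torus_embed: "continuous_on S torus_embed"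
  unfolding torus_embed_def[abs_def] by (intro continuous_intros)

text \<open>Equal cosines and sines force the coordinates to differ by integers, and two numbers
  strictly between 0 and 1 differ by less than 1.\<close>

lemma torus_embed_inj_box:
  assumes x: "x \<in> box 0 1" and y: "y \<in> box 0 1" and eq: "torus_embed x = torus_embed y"
  shows "x = y"
proof (subst vec_eq_iff, rule allI)
  fix i
  have "sin (2 * pi * x $ i) = sin (2 * pi * y $ i)" "cos (2 * pi * x $ i) = cos (2 * pi * y $ i)"
    using eq by (simp_all add: torus_embed_def vec_eq_iff)
  then obtain n :: int where "2 * pi * x $ i = 2 * pi * y $ i + 2 * pi * n"
    using sin_cos_eq_iff[of "2 * pi * x $ i" "2 * pi * y $ i"] by blast
  then have "2 * pi * x $ i = 2 * pi * (y $ i + n)" by (simp add: algebra_simps)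
  then have n: "x $ i = y $ i + n" by simp
  have "0 < x $ i" "x $ i < 1" "0 < y $ i" "y $ i < 1" using x y by (simp_all add: mem_box_cart)
  with n have "\<bar>real_of_int n\<bar> < 1" by linarith
  then have "n = 0" by linarith
  with n show "x $ i = y $ i" by simp
qed

lemma phase_axis_freq: "phase (axis i 1) x = 2 * pi * x $ i"
proof -
  have "(\<Sum>j\<in>UNIV. real_of_int (axis i 1 $ j) * x $ j) = (\<Sum>j\<in>UNIV. if j = i then x $ j else 0)"
    by (rule sum.cong) (auto simp: axis_def)
  then show ?thesis by (simp add: phase_def)
qed

lemma torus_embed_expansion:
  "torus_embed x = (\<Sum>i\<in>UNIV. cosm (axis i 1) x *\<^sub>R (axis i 1, 0) + sinm (axis i 1) x *\<^sub>R (0, axis i 1))"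
  by (simp add: torus_embed_def prod_eq_iff fst_sum snd_sum vec_eq_iff phase_axis_freq)
    (simp add: axis_def if_distrib cong: if_cong)

text \<open>Linear functionals pull back to combinations of modes at the unit frequencies;
  constants, sums and products stay trigonometric.\<close>

lemma trig_sum_polynomial:
  "real_polynomial_function p \<Longrightarrow> trig_sum (\<lambda>x. p (torus_embed x))"
proof (induction rule: real_polynomial_function.induct)
  case (linear f)
  then have lin: "linear f" by (rule bounded_linear.linear)
  have "trig_sum (\<lambda>x. \<Sum>i\<in>UNIV. f (axis i 1, 0) * cosm (axis i 1) x + f (0, axis i 1) * sinm (axis i 1) x)"
    by (intro trig_sum_sum trig_sum_base) simp
  then show ?case
    unfolding torus_embed_expansion linear_sum[OF lin] linear_add[OF lin] linear_scale[OF lin]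
    by (simp add: mult.commute)
qed (auto intro: trig_sum_const trig_sum_add trig_sum_mult)

section \<open>The mean-square closure of the trigonometric polynomials\<close>

definition trig_approx :: "(real^3 \<Rightarrow> real) \<Rightarrow> bool" where
  "trig_approx f \<longleftrightarrow> sq_int f \<and> (\<forall>e>0. \<exists>p. trig_sum p \<and> (\<integral>x. (f x - p x)\<^sup>2 \<partial>T3) < e)"

lemma trig_approx_near:
  assumes f: "sq_int f" and near: "\<And>e. e > 0 \<Longrightarrow> \<exists>g. trig_approx g \<and> (\<integral>x. (f x - g x)\<^sup>2 \<partial>T3) < e"
  shows "trig_approx f"
  unfolding trig_approx_def
proof (intro conjI allI impI f)
  fix e :: real assume "e > 0"
  then obtain g where g: "trig_approx g" "(\<integral>x. (f x - g x)\<^sup>2 \<partial>T3) < e / 4"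
    using near[of "e / 4"] by auto
  then obtain p where p: "trig_sum p" "(\<integral>x. (g x - p x)\<^sup>2 \<partial>T3) < e / 4"
    unfolding trig_approx_def using \<open>e > 0\<close> by (metis zero_less_divide_iff zero_less_numeral)
  have "sq_int (\<lambda>x. f x - g x)" "sq_int (\<lambda>x. g x - p x)"
    using f g p trig_sum_sq_int by (auto intro!: sq_int_diff simp: trig_approx_def)
  from integral_sq_triangle[OF this] g p have "(\<integral>x. (f x - p x)\<^sup>2 \<partial>T3) < e" by simp
  with p show "\<exists>p. trig_sum p \<and> (\<integral>x. (f x - p x)\<^sup>2 \<partial>T3) < e" by blast
qed

text \<open>Dominated convergence: pointwise limits under a square-integrable bound are also
  mean-square limits, and the closure is closed under these.\<close>

lemma trig_approx_limit:
  assumes s: "\<And>n. trig_approx (s n)" and f: "f \<in> borel_measurable T3"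
    and w: "integrable T3 (\<lambda>x. (w x)\<^sup>2)"
    and lim: "AE x in T3. (\<lambda>n. s n x) \<longlonglongrightarrow> f x"
    and bound: "\<And>n. AE x in T3. \<bar>s n x\<bar> \<le> w x"
  shows "trig_approx f"
proof -
  have [measurable]: "s n \<in> borel_measurable T3" for n
    using s[of n] by (simp add: trig_approx_def sq_int_def)
  note f [measurable]
  have bound': "AE x in T3. \<forall>n. \<bar>s n x\<bar> \<le> w x" using bound by (simp add: AE_all_countable)
  have fb: "AE x in T3. \<bar>f x\<bar> \<le> w x"
    using lim bound'
  proof eventually_elim
    case (elim x)
    have "(\<lambda>n. \<bar>s n x\<bar>) \<longlonglongrightarrow> \<bar>f x\<bar>" using elim(1) by (rule tendsto_rabs)
    then show ?case by (rule LIMSEQ_le_const2) (use elim(2) in auto)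
  qed
  have fint: "integrable T3 (\<lambda>x. (f x)\<^sup>2)"
    by (rule Bochner_Integration.integrable_bound[OF w]) (use fb in \<open>auto elim!: eventually_mono simp flip: abs_le_square_iff\<close>)
  have "(\<lambda>n. \<integral>x. (f x - s n x)\<^sup>2 \<partial>T3) \<longlonglongrightarrow> (\<integral>x. 0 \<partial>T3)"
  \<comment> \<open>Both \<open>f\<close> and \<open>s n\<close> are bounded by \<open>w\<close>
    almost everywhere, so their difference is bounded by twice \<open>w\<close>; squaring gives the
    4.\<close>
  proof (rule integral_dominated_convergence[where w = "\<lambda>x. 4 * (w x)\<^sup>2"])
    show "integrable T3 (\<lambda>x. 4 * (w x)\<^sup>2)" using w by simp
    show "AE x in T3. (\<lambda>n. (f x - s n x)\<^sup>2) \<longlonglongrightarrow> 0"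
      using lim
    proof eventually_elim
      case (elim x)
      have "(\<lambda>n. (f x - s n x)\<^sup>2) \<longlonglongrightarrow> (f x - f x)\<^sup>2" using elim by (intro tendsto_intros)
      then show ?case by simp
    qed
    show "AE x in T3. norm ((f x - s n x)\<^sup>2) \<le> 4 * (w x)\<^sup>2" for n
      using bound' fb
    proof eventually_elim
      case (elim x)
      have "\<bar>s n x\<bar> \<le> w x" using elim(1) by blast
      with elim(2) have "\<bar>f x - s n x\<bar> \<le> 2 * w x" by linarith
      then have "(f x - s n x)\<^sup>2 \<le> (2 * w x)\<^sup>2" by (metis abs_ge_zero power2_abs power_mono)
      then show ?case by (simp add: power_mult_distrib)
    qed
  qed simp_all
  then have l: "(\<lambda>n. \<integral>x. (f x - s n x)\<^sup>2 \<partial>T3) \<longlonglongrightarrow> 0" by simp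
  show ?thesis
  proof (rule trig_approx_near)
    show "sq_int f" using fint by (simp add: sq_int_def)
    fix e :: real assume "e > 0"
    from order_tendstoD(2)[OF l this] obtain n where "(\<integral>x. (f x - s n x)\<^sup>2 \<partial>T3) < e"
      by (auto simp: eventually_sequentially)
    then show "\<exists>g. trig_approx g \<and> (\<integral>x. (f x - g x)\<^sup>2 \<partial>T3) < e" using s by blast
  qed
qed

lemma trig_approx_add:
  assumes f: "trig_approx f" and g: "trig_approx g"
  shows "trig_approx (\<lambda>x. f x + g x)"
  unfolding trig_approx_def
proof (intro conjI allI impI)
  show "sq_int (\<lambda>x. f x + g x)" using f g by (auto intro: sq_int_add simp: trig_approx_def)
  fix e :: real assume "e > 0"
  then have "e / 4 > 0" by simp
  then obtain p q where p: "trig_sum p" "(\<integral>x. (f x - p x)\<^sup>2 \<partial>T3) < e / 4"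
    and q: "trig_sum q" "(\<integral>x. (g x - q x)\<^sup>2 \<partial>T3) < e / 4"
    using f g unfolding trig_approx_def by meson
  have "sq_int (\<lambda>x. f x - p x)" "sq_int (\<lambda>x. g x - q x)"
    using f g p q trig_sum_sq_int by (auto intro!: sq_int_diff simp: trig_approx_def)
  from integral_sq_triangle[OF this] p q have "(\<integral>x. (f x + g x - (p x + q x))\<^sup>2 \<partial>T3) < e"
    by (simp add: algebra_simps)
  with trig_sum_add[OF p(1) q(1)] show "\<exists>p. trig_sum p \<and> (\<integral>x. (f x + g x - p x)\<^sup>2 \<partial>T3) < e" by blast
qed

lemma trig_approx_trig_sum: "trig_sum p \<Longrightarrow> trig_approx p"
  unfolding trig_approx_def by (auto intro: trig_sum_sq_int intro!: exI[of _ p])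

lemma trig_approx_cmult:
  assumes f: "trig_approx f"
  shows "trig_approx (\<lambda>x. c * f x)"
proof (cases "c = 0")
  case True
  then show ?thesis using trig_approx_trig_sum[OF trig_sum_const[of 0]] by simp
next
  case False
  show ?thesis
    unfolding trig_approx_def
  proof (intro conjI allI impI)
    show "sq_int (\<lambda>x. c * f x)" using f by (auto intro: sq_int_cmult simp: trig_approx_def)
    fix e :: real assume "e > 0"
    then have "e / c\<^sup>2 > 0" using False by simp
    then obtain p where p: "trig_sum p" "(\<integral>x. (f x - p x)\<^sup>2 \<partial>T3) < e / c\<^sup>2"
      using f unfolding trig_approx_def by meson
    have "(\<integral>x. (c * f x - c * p x)\<^sup>2 \<partial>T3) = c\<^sup>2 * (\<integral>x. (f x - p x)\<^sup>2 \<partial>T3)"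
      by (simp add: right_diff_distrib[symmetric] power_mult_distrib)
    also have "\<dots> < e" using p(2) False by (simp add: field_simps)
    finally show "\<exists>p. trig_sum p \<and> (\<integral>x. (c * f x - p x)\<^sup>2 \<partial>T3) < e"
      using trig_sum_cmult[OF p(1)] by blast
  qed
qed

lemma trig_approx_sum:
  "finite A \<Longrightarrow> (\<And>i. i \<in> A \<Longrightarrow> trig_approx (f i)) \<Longrightarrow> trig_approx (\<lambda>x. \<Sum>i\<in>A. f i x)"
  by (induction A rule: finite_induct)
    (simp_all add: trig_approx_add trig_approx_trig_sum[OF trig_sum_const])

text \<open>Stone-Weierstrass on the compact image of the cell approximates \<open>g\<close>
  uniformly by polynomials, which pull back to trigonometric polynomials.\<close>

lemma trig_approx_continuous_embed:
  assumes g: "continuous_on UNIV g"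
  shows "trig_approx (\<lambda>x. g (torus_embed x))"
proof (rule trig_approx_near)
  have c: "continuous_on UNIV (\<lambda>x. g (torus_embed x))"
    by (rule continuous_on_compose2[OF g continuous_torus_embed]) simp
  then show sq: "sq_int (\<lambda>x. g (torus_embed x))" by (rule sq_int_continuous)
  fix e :: real assume "e > 0"
  have "compact (torus_embed ` cbox 0 1)"
    by (intro compact_continuous_image continuous_torus_embed) simp
  then obtain p where p: "real_polynomial_function p"
      \<comment> \<open>The cell has volume 1, so a uniform error of sqrt (e / 2) gives a
        mean-square error of at most e / 2, strictly below e.\<close>
      "\<And>z. z \<in> torus_embed ` cbox 0 1 \<Longrightarrow> \<bar>g z - p z\<bar> < sqrt (e / 2)"
    using Stone_Weierstrass_real_polynomial_function[of "torus_embed ` cbox 0 1" g "sqrt (e / 2)"]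
      continuous_on_subset[OF g] \<open>e > 0\<close> by auto
  let ?q = "\<lambda>x. p (torus_embed x)"
  have q: "trig_sum ?q" by (rule trig_sum_polynomial[OF p(1)])
  have "(\<integral>x. (g (torus_embed x) - ?q x)\<^sup>2 \<partial>T3) \<le> (\<integral>x. e / 2 \<partial>T3)"
  proof (rule integral_mono)
    show "integrable T3 (\<lambda>x. (g (torus_embed x) - ?q x)\<^sup>2)"
      using sq_int_diff[OF sq trig_sum_sq_int[OF q]] by (rule sq_int_integrable)
    show "integrable T3 (\<lambda>x. e / 2)" by (rule continuous_imp_integrable_T3) simp
    fix x assume "x \<in> space T3"
    then have "\<bar>g (torus_embed x) - ?q x\<bar> \<le> sqrt (e / 2)" using p(2)[of "torus_embed x"] by simp
    then have "\<bar>g (torus_embed x) - ?q x\<bar>\<^sup>2 \<le> (sqrt (e / 2))\<^sup>2" by (rule power_mono) simp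
    then show "(g (torus_embed x) - ?q x)\<^sup>2 \<le> e / 2" using \<open>e > 0\<close> by simp
  qed
  also have "\<dots> < e" using \<open>e > 0\<close> by simp
  finally show "\<exists>h. trig_approx h \<and> (\<integral>x. (g (torus_embed x) - h x)\<^sup>2 \<partial>T3) < e"
    using trig_approx_trig_sum[OF q] by blast
qed

lemma AE_T3_box: "AE x in T3. x \<in> box 0 1"
proof -
  have "AE x in lebesgue. x \<notin> cbox 0 1 - box (0::real^3) 1"
    by (rule AE_not_in) (simp only: negligible_iff_null_sets[symmetric] negligible_frontier_interval)
  then show ?thesis unfolding T3_def by (subst AE_restrict_space_iff) (auto elim!: eventually_mono)
qed

text \<open>
  Since the embedding is injective on the open cube, the distance to the image of a compact set \<open>K\<close>
  separates \<open>K\<close> from its complement there, without any discussion of the quotient topology.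
\<close>

lemma trig_approx_compact_indicator:
  assumes K: "compact K" "K \<subseteq> box 0 1"
  shows "trig_approx (indicator K)"
proof (cases "K = {}")
  case True
  then have "indicator K = (\<lambda>_. 0 :: real)" by (simp add: fun_eq_iff)
  then show ?thesis using trig_approx_trig_sum[OF trig_sum_const[of 0]] by simp
next
  case False
  let ?C = "torus_embed ` K"
  have C: "closed ?C" "?C \<noteq> {}"
    using K(1) False compact_continuous_image[OF continuous_torus_embed] by (auto intro: compact_imp_closed)
  \<comment> \<open>Continuous tents: equal to 1 on the image of \<open>K\<close> and, for positive
    n, equal to 0 at distance at least 1 / n from it.\<close>
  let ?g = "\<lambda>n z. max 0 (1 - real n * infdist z ?C)"
  have Kl: "K \<in> sets lebesgue" using K(1) by (simp add: lmeasurable_compact fmeasurableD)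
  show ?thesis
  proof (rule trig_approx_limit)
    show "trig_approx (\<lambda>x. ?g n (torus_embed x))" for n
      by (rule trig_approx_continuous_embed) (intro continuous_intros)
    show "indicator K \<in> borel_measurable T3"
      unfolding T3_def using Kl by (intro measurable_restrict_space1 borel_measurable_indicator)
    show "integrable T3 (\<lambda>x. (1::real)\<^sup>2)" by (rule continuous_imp_integrable_T3) simp
    show "AE x in T3. \<bar>?g n (torus_embed x)\<bar> \<le> 1" for n
      by (rule AE_I2) (simp add: infdist_nonneg)
    show "AE x in T3. (\<lambda>n. ?g n (torus_embed x)) \<longlonglongrightarrow> indicator K x"
      using AE_T3_box
    proof eventually_elim
      case (elim x)
      show ?case
      proof (cases "x \<in> K")
        case True
        then show ?thesis by simp
      next
        case False
        then have "torus_embed x \<notin> ?C" using torus_embed_inj_box[OF elim] K(2) by blast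
        then have d: "infdist (torus_embed x) ?C > 0" by (rule infdist_pos_not_in_closed[OF C])
        then obtain N where N: "real N * infdist (torus_embed x) ?C > 1"
          using reals_Archimedean3 by blast
        have "?g n (torus_embed x) = 0" if "n \<ge> N" for n
        proof -
          have "real N * infdist (torus_embed x) ?C \<le> real n * infdist (torus_embed x) ?C"
            using that d by (intro mult_right_mono) auto
          with N show ?thesis by simp
        qed
        then have "eventually (\<lambda>n. ?g n (torus_embed x) = indicator K x) sequentially"
          using False by (auto simp: eventually_sequentially)
        then show ?thesis by (rule tendsto_eventually)
      qed
    qed
  qed
qed

text \<open>Inner regularity reduces a measurable set to a compact one. The part of the set on the
  boundary of the cell is null and is discarded first, so that the compact set lies in the open
  cube.\<close>

lemma trig_approx_indicator:
  assumes A: "A \<in> sets T3"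
  shows "trig_approx (indicator A)"
proof (rule trig_approx_near)
  have Al: "A \<in> sets lebesgue" using A by (auto simp: T3_def sets_restrict_space_iff)
  have sq: "sq_int (indicator B)" if "B \<in> sets T3" for B
  proof -
    have "integrable T3 (\<lambda>x. (indicator B x)\<^sup>2 :: real)"
    proof -
      have "(\<lambda>x. (indicator B x)\<^sup>2 :: real) = indicator B" by (auto simp: indicator_def)
      moreover have "B \<inter> cbox 0 1 = B" using sets.sets_into_space[OF that] by auto
      ultimately show ?thesis
        using that finite_measure.emeasure_finite[OF finite_measure_T3, of B]
        by (simp add: integrable_indicator_iff less_top)
    qed
    then show ?thesis using that by (simp add: sq_int_def)
  qed
  then show "sq_int (indicator A)" using A by blast
  fix e :: real assume e: "e > 0"
  let ?A = "A \<inter> box 0 1"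
  have "?A \<in> sets lebesgue" by (intro sets.Int Al) simp
  then obtain K where K: "closed K" "K \<subseteq> ?A" "?A - K \<in> lmeasurable" "emeasure lebesgue (?A - K) < ennreal e"
    using sets_lebesgue_inner_closed[OF _ e] by blast
  have "bounded K" using K(2) bounded_box bounded_subset by blast
  then have cK: "compact K" using K(1) compact_eq_bounded_closed by blast
  have D: "?A - K \<in> sets T3" using K(3) by (auto simp: T3_def sets_restrict_space_iff box_subset_cbox
     intro: fmeasurableD dest: subsetD[OF box_subset_cbox])
  have "(\<integral>x. (indicator A x - indicator K x)\<^sup>2 \<partial>T3) = (\<integral>x. (indicator (?A - K) x :: real) \<partial>T3)"
  proof (rule integral_cong_AE)
    have "K \<in> sets T3" using K(2) cK by (auto simp: T3_def sets_restrict_space_iff 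
     intro: fmeasurableD lmeasurable_compact dest: subsetD[OF box_subset_cbox])
    then show "(\<lambda>x. (indicator A x - indicator K x)\<^sup>2 :: real) \<in> borel_measurable T3" using A by measurable
    show "indicator (?A - K) \<in> borel_measurable T3" using D by simp
    show "AE x in T3. (indicator A x - indicator K x)\<^sup>2 = (indicator (?A - K) x :: real)"
      using AE_T3_box by eventually_elim (use K(2) in \<open>auto simp: indicator_def\<close>)
  qed
  also have "\<dots> = measure T3 (?A - K)" using sets.sets_into_space[OF D] by (simp add: Int_absorb2)
  also have "\<dots> = measure lebesgue (?A - K)"
    unfolding T3_def by (rule measure_restrict_space) (use box_subset_cbox in auto)
  also have "\<dots> < e" using K(4) e by (simp add: emeasure_eq_measure2[OF K(3)] ennreal_less_iff)
  finally show "\<exists>g. trig_approx g \<and> (\<integral>x. (indicator A x - g x)\<^sup>2 \<partial>T3) < e"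
    using trig_approx_compact_indicator[OF cK] K(2) by blast
qed

text \<open>Simple functions converging pointwise and dominated by twice
  \<open>\<bar>f\<bar>\<close> reduce the claim to indicators.\<close>

lemma trig_approx_L2:
  assumes f: "sq_int f"
  shows "trig_approx f"
proof -
  note m = sq_int_measurable[OF f]
  obtain F where F: "\<And>i. simple_function T3 (F i)" "\<And>x. x \<in> space T3 \<Longrightarrow> (\<lambda>i. F i x) \<longlonglongrightarrow> f x"
      "\<And>i x. x \<in> space T3 \<Longrightarrow> dist (F i x) 0 \<le> 2 * dist (f x) 0"
    using borel_measurable_implies_sequence_metric[OF m, of 0] by blast
  show ?thesis
  proof (rule trig_approx_limit[where w = "\<lambda>x. 2 * \<bar>f x\<bar>"])
    show "f \<in> borel_measurable T3" by fact
    show "integrable T3 (\<lambda>x. (2 * \<bar>f x\<bar>)\<^sup>2)"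
      using sq_int_integrable[OF f] by (simp add: power_mult_distrib)
    show "AE x in T3. (\<lambda>n. F n x) \<longlonglongrightarrow> f x" using F(2) by (rule AE_I2)
    show "AE x in T3. \<bar>F n x\<bar> \<le> 2 * \<bar>f x\<bar>" for n using F(3)[of _ n] by (intro AE_I2) simp
    show "trig_approx (F n)" for n
    proof -
      let ?G = "\<lambda>x. \<Sum>y\<in>F n ` space T3. y * indicator (F n -` {y} \<inter> space T3) x"
      have fin: "finite (F n ` space T3)" using F(1)[of n] by (simp add: simple_function_def)
      have G: "trig_approx ?G"
        using F(1)[of n] by (intro trig_approx_sum trig_approx_cmult trig_approx_indicator fin)
          (auto simp: simple_function_def)
      have "?G x = F n x" if "x \<in> space T3" for x
      proof -
        have "?G x = (\<Sum>y\<in>F n ` space T3. if y = F n x then y else 0)"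
          using that by (intro sum.cong) (auto simp: indicator_def)
        then show ?thesis using fin that by simp
      qed
      then have eq: "AE x in T3. ?G x = F n x" by (intro AE_I2)
      show ?thesis
      \<comment> \<open>\<open>F n\<close> and \<open>?G\<close> agree only on the cell, not as
        functions on the whole space; the limit of a constant sequence transfers the property
        between them.\<close>
      proof (rule trig_approx_limit[where s = "\<lambda>_. ?G" and w = "\<lambda>x. \<bar>?G x\<bar>"])
        show "AE x in T3. (\<lambda>_. ?G x) \<longlonglongrightarrow> F n x"
          using eq by eventually_elim simp
        show "F n \<in> borel_measurable T3" using F(1) by (rule borel_measurable_simple_function)
        show "integrable T3 (\<lambda>x. \<bar>?G x\<bar>\<^sup>2)" using G by (simp add: trig_approx_def sq_int_def)
      qed (use G in simp_all)
    qed
  qed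
qed

section \<open>Fourier projections of scalar functions\<close>

text \<open>The complex Fourier coefficient of \<open>f\<close> at k is \<open>fcos k f\<close>
  minus i times \<open>fsin k f\<close>.\<close>

definition fcos :: "int^3 \<Rightarrow> (real^3 \<Rightarrow> real) \<Rightarrow> real" where
  "fcos k f = (\<integral>x. f x * cosm k x \<partial>T3)"

definition fsin :: "int^3 \<Rightarrow> (real^3 \<Rightarrow> real) \<Rightarrow> real" where
  "fsin k f = (\<integral>x. f x * sinm k x \<partial>T3)"

text \<open>
  On a set of frequencies closed under negation, pairing the terms for \<open>k\<close> and \<open>-k\<close> shows that
  this is the orthogonal projection onto the span of the modes \<open>exp (2 \<pi> i k \<cdot> x)\<close>. Each real mode is
  then counted twice, which is why no normalising factor 2 appears.
\<close>

definition fproj :: "(int^3) set \<Rightarrow> (real^3 \<Rightarrow> real) \<Rightarrow> real^3 \<Rightarrow> real" where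
  "fproj K f x = (\<Sum>k\<in>K. fcos k f * cosm k x + fsin k f * sinm k x)"

lemma sq_int_trig: "sq_int (cosm k)" "sq_int (sinm k)"
  by (rule sq_int_continuous, intro continuous_intros)+

lemma integrable_mult_trig:
  assumes "sq_int f"
  shows "integrable T3 (\<lambda>x. f x * cosm k x)" "integrable T3 (\<lambda>x. f x * sinm k x)"
  using sq_int_mult_integrable[OF assms sq_int_trig(1)] sq_int_mult_integrable[OF assms sq_int_trig(2)] by auto

lemma trig_sum_fproj: "finite K \<Longrightarrow> trig_sum (fproj K f)"
  unfolding fproj_def[abs_def] by (intro trig_sum_sum trig_sum_base)

lemma sq_int_fproj: "finite K \<Longrightarrow> sq_int (fproj K f)"
  by (intro trig_sum_sq_int trig_sum_fproj)

lemma fcos_uminus [simp]: "fcos (- k) f = fcos k f" and fsin_uminus [simp]: "fsin (- k) f = - fsin k f"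
  by (simp_all add: fcos_def fsin_def phase_minus)

lemma fcos_diff: "sq_int f \<Longrightarrow> sq_int g \<Longrightarrow> fcos k (\<lambda>x. f x - g x) = fcos k f - fcos k g"
  and fsin_diff: "sq_int f \<Longrightarrow> sq_int g \<Longrightarrow> fsin k (\<lambda>x. f x - g x) = fsin k f - fsin k g"
  using integrable_mult_trig[of f k] integrable_mult_trig[of g k]
  by (simp_all add: fcos_def fsin_def left_diff_distrib)

text \<open>Reduces inner products with a projection to coefficients: for \<open>g\<close> a mode it
  yields the coefficients of the projection, for \<open>g = f\<close> the energy.\<close>

lemma integral_mult_fproj:
  assumes g: "sq_int g" and K: "finite K"
  shows "(\<integral>x. g x * fproj K f x \<partial>T3) = (\<Sum>k\<in>K. fcos k f * fcos k g + fsin k f * fsin k g)"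
proof -
  have "(\<integral>x. g x * fproj K f x \<partial>T3)
      = (\<integral>x. (\<Sum>k\<in>K. fcos k f * (g x * cosm k x) + fsin k f * (g x * sinm k x)) \<partial>T3)"
    by (simp add: fproj_def sum_distrib_left algebra_simps)
  also have "\<dots> = (\<Sum>k\<in>K. fcos k f * fcos k g + fsin k f * fsin k g)"
    using integrable_mult_trig[OF g] by (simp add: fcos_def fsin_def)
  finally show ?thesis .
qed

lemma fcos_trig:
  "fcos l (cosm k) = ((if k = l then 1 else 0) + (if k = - l then 1 else 0)) / 2"
  "fcos l (sinm k) = 0" "fsin l (cosm k) = 0"
  "fsin l (sinm k) = ((if k = l then 1 else 0) - (if k = - l then 1 else 0)) / 2"
  by (simp_all only: fcos_def fsin_def orthogonality)

text \<open>The real mode at l occurs in the sum at k = l and at k = -l, each contributing half of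
  the coefficient. This is where the symmetry of \<open>K\<close> enters.\<close>

lemma coeffs_fproj:
  assumes K: "finite K" and sym: "\<And>k. k \<in> K \<Longrightarrow> - k \<in> K" and l: "l \<in> K"
  shows "fcos l (fproj K f) = fcos l f" "fsin l (fproj K f) = fsin l f"
proof -
  have l': "- l \<in> K" using sym l by blast
  have flip: "l = k \<longleftrightarrow> k = l" "- k = l \<longleftrightarrow> k = - l" for k by auto
  have split: "a * (((if P then 1 else 0) + (if Q then 1 else 0)) / 2) = (if P then a / 2 else 0) + (if Q then a / 2 else 0)"
    "a * (((if P then 1 else 0) - (if Q then 1 else 0)) / 2) = (if P then a / 2 else 0) + (if Q then - a / 2 else 0)"
    for a :: real and P Q by simp_all
  have "fcos l (fproj K f) = (\<integral>x. cosm l x * fproj K f x \<partial>T3)" by (simp add: fcos_def mult.commute)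
  also have "\<dots> = (\<Sum>k\<in>K. fcos k f * fcos k (cosm l) + fsin k f * fsin k (cosm l))"
    by (rule integral_mult_fproj[OF sq_int_trig(1) K])
  also have "\<dots> = (\<Sum>k\<in>K. (if k = l then fcos k f / 2 else 0) + (if k = - l then fcos k f / 2 else 0))"
    by (intro sum.cong refl) (simp only: fcos_trig flip split mult_zero_right add_0_left add_0_right)
  also have "\<dots> = fcos l f" using K l l' by (simp add: sum.distrib)
  finally show "fcos l (fproj K f) = fcos l f" .
  have "fsin l (fproj K f) = (\<integral>x. sinm l x * fproj K f x \<partial>T3)" by (simp add: fsin_def mult.commute)
  also have "\<dots> = (\<Sum>k\<in>K. fcos k f * fcos k (sinm l) + fsin k f * fsin k (sinm l))"
    by (rule integral_mult_fproj[OF sq_int_trig(2) K])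
  also have "\<dots> = (\<Sum>k\<in>K. (if k = l then fsin k f / 2 else 0) + (if k = - l then - fsin k f / 2 else 0))"
    by (intro sum.cong refl) (simp only: fcos_trig flip split mult_zero_right add_0_left add_0_right)
  also have "\<dots> = fsin l f" using K l l' by (simp add: sum.distrib)
  finally show "fsin l (fproj K f) = fsin l f" .
qed

section \<open>Bessel inequality and mean-square convergence of Fourier projections\<close>

definition energy :: "(int^3) set \<Rightarrow> (real^3 \<Rightarrow> real) \<Rightarrow> real" where
  "energy K f = (\<Sum>k\<in>K. (fcos k f)\<^sup>2 + (fsin k f)\<^sup>2)"

lemma integral_fproj_sq:
  assumes K: "finite K" and sym: "\<And>k. k \<in> K \<Longrightarrow> - k \<in> K"
  shows "(\<integral>x. (fproj K f x)\<^sup>2 \<partial>T3) = energy K f"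
proof -
  have "(\<integral>x. (fproj K f x)\<^sup>2 \<partial>T3)
      = (\<Sum>k\<in>K. fcos k f * fcos k (fproj K f) + fsin k f * fsin k (fproj K f))"
    using integral_mult_fproj[OF sq_int_fproj[OF K] K] by (simp add: power2_eq_square)
  also have "\<dots> = energy K f"
    unfolding energy_def by (intro sum.cong refl) (simp only: coeffs_fproj[OF K sym] power2_eq_square)
  finally show ?thesis .
qed

lemma fproj_pythagoras:
  assumes f: "sq_int f" and K: "finite K" and sym: "\<And>k. k \<in> K \<Longrightarrow> - k \<in> K"
  shows "(\<integral>x. (f x)\<^sup>2 \<partial>T3) = (\<integral>x. (f x - fproj K f x)\<^sup>2 \<partial>T3) + energy K f"
proof -
  have E: "(\<integral>x. f x * fproj K f x \<partial>T3) = energy K f"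
    by (simp add: integral_mult_fproj[OF f K] energy_def power2_eq_square)
  have "(\<integral>x. (f x - fproj K f x)\<^sup>2 \<partial>T3) = (\<integral>x. (f x)\<^sup>2 - 2 * (f x * fproj K f x) + (fproj K f x)\<^sup>2 \<partial>T3)"
    by (simp add: power2_diff algebra_simps)
  also have "\<dots> = (\<integral>x. (f x)\<^sup>2 \<partial>T3) - 2 * energy K f + energy K f"
    using sq_int_integrable[OF f] sq_int_mult_integrable[OF f sq_int_fproj[OF K]]
      sq_int_integrable[OF sq_int_fproj[OF K]]
    by (simp add: E integral_fproj_sq[OF K sym])
  finally show ?thesis by simp
qed

lemma bessel:
  assumes f: "sq_int f" and K: "finite K" "\<And>k. k \<in> K \<Longrightarrow> - k \<in> K"
  shows "energy K f \<le> (\<integral>x. (f x)\<^sup>2 \<partial>T3)"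
  using fproj_pythagoras[OF f K] by simp

text \<open>Records that a trigonometric polynomial involves finitely many frequencies, phrased by
  duality so that no coefficients have to be extracted from the inductive definition.\<close>

lemma trig_sum_orthogonal:
  "trig_sum p \<Longrightarrow> \<exists>K0. finite K0 \<and> (\<forall>u. sq_int u \<and> (\<forall>k\<in>K0. fcos k u = 0 \<and> fsin k u = 0)
      \<longrightarrow> (\<integral>x. u x * p x \<partial>T3) = 0)"
proof (induction rule: trig_sum.induct)
  case (trig_sum_base a k b)
  have "(\<integral>x. u x * (a * cosm k x + b * sinm k x) \<partial>T3) = 0"
    if u: "sq_int u" and z: "fcos k u = 0" "fsin k u = 0" for u
  proof -
    have "(\<integral>x. u x * (a * cosm k x + b * sinm k x) \<partial>T3) = (\<integral>x. a * (u x * cosm k x) + b * (u x * sinm k x) \<partial>T3)"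
      by (simp add: algebra_simps)
    also have "\<dots> = a * fcos k u + b * fsin k u"
      using integrable_mult_trig[OF u] by (simp add: fcos_def fsin_def)
    finally show ?thesis using z by simp
  qed
  then show ?case by (intro exI[of _ "{k}"]) simp
next
  case (trig_sum_add p q)
  let ?orth = "\<lambda>K p. \<forall>u. sq_int u \<and> (\<forall>k\<in>K. fcos k u = 0 \<and> fsin k u = 0) \<longrightarrow> (\<integral>x. u x * p x \<partial>T3) = 0"
  from trig_sum_add.IH obtain K L where KL: "finite K" "finite L" and K: "?orth K p" and L: "?orth L q"
    by (elim exE conjE)
  have "(\<integral>x. u x * (p x + q x) \<partial>T3) = 0"
    if u: "sq_int u" and z: "\<forall>k\<in>K \<union> L. fcos k u = 0 \<and> fsin k u = 0" for u
  proof -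
    have "(\<integral>x. u x * (p x + q x) \<partial>T3) = (\<integral>x. u x * p x \<partial>T3) + (\<integral>x. u x * q x \<partial>T3)"
      using sq_int_mult_integrable[OF u trig_sum_sq_int] trig_sum_add.hyps by (simp add: distrib_left)
    then show ?thesis using K[rule_format, of u] L[rule_format, of u] u z by simp
  qed
  then show ?case using KL by (intro exI[of _ "K \<union> L"]) auto
qed

text \<open>Best approximation: once \<open>K\<close> contains the frequencies of a good approximant
  \<open>p\<close>, the error of the projection is orthogonal to the projection and to
  \<open>p\<close>, hence no larger than that of \<open>p\<close>.\<close>

lemma fproj_approximates:
  assumes f: "sq_int f" and e: "e > 0"
  shows "\<exists>K0. finite K0 \<and> (\<forall>K. finite K \<and> K0 \<subseteq> K \<and> (\<forall>k\<in>K. - k \<in> K)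
    \<longrightarrow> (\<integral>x. (f x - fproj K f x)\<^sup>2 \<partial>T3) < e)"
proof -
  obtain p where p: "trig_sum p" "(\<integral>x. (f x - p x)\<^sup>2 \<partial>T3) < e"
    using trig_approx_L2[OF f] e unfolding trig_approx_def by blast
  obtain K0 where K0: "finite K0" and orth: "\<And>u. sq_int u \<Longrightarrow> \<forall>k\<in>K0. fcos k u = 0 \<and> fsin k u = 0
      \<Longrightarrow> (\<integral>x. u x * p x \<partial>T3) = 0"
    using trig_sum_orthogonal[OF p(1)] by meson
  have "(\<integral>x. (f x - fproj K f x)\<^sup>2 \<partial>T3) < e"
    if K: "finite K" "K0 \<subseteq> K" and sym: "\<And>k. k \<in> K \<Longrightarrow> - k \<in> K" for K
  proof -
    let ?u = "\<lambda>x. f x - fproj K f x" and ?d = "\<lambda>x. fproj K f x - p x"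
    have S: "sq_int (fproj K f)" by (rule sq_int_fproj[OF K(1)])
    have u: "sq_int ?u" by (rule sq_int_diff[OF f S])
    have d: "sq_int ?d" by (rule sq_int_diff[OF S trig_sum_sq_int[OF p(1)]])
    have zero: "fcos k ?u = 0" "fsin k ?u = 0" if "k \<in> K" for k
      using coeffs_fproj[OF K(1) sym that, of f] by (simp_all add: fcos_diff[OF f S] fsin_diff[OF f S])
    have "(\<integral>x. ?u x * fproj K f x \<partial>T3) = 0"
      by (simp add: integral_mult_fproj[OF u K(1)] zero)
    moreover have "(\<integral>x. ?u x * p x \<partial>T3) = 0" using orth[OF u] zero K(2) by blast
    ultimately have ud: "(\<integral>x. ?u x * ?d x \<partial>T3) = 0"
      using sq_int_mult_integrable[OF u S] sq_int_mult_integrable[OF u trig_sum_sq_int[OF p(1)]]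
      by (simp add: right_diff_distrib)
    have "(f x - p x)\<^sup>2 = (?u x)\<^sup>2 + 2 * (?u x * ?d x) + (?d x)\<^sup>2" for x
      by (simp add: power2_eq_square algebra_simps)
    then have "(\<integral>x. (f x - p x)\<^sup>2 \<partial>T3) = (\<integral>x. (?u x)\<^sup>2 + 2 * (?u x * ?d x) + (?d x)\<^sup>2 \<partial>T3)"
      by (simp only:)
    also have "\<dots> = (\<integral>x. (?u x)\<^sup>2 \<partial>T3) + (\<integral>x. (?d x)\<^sup>2 \<partial>T3)"
      using sq_int_integrable[OF u] sq_int_integrable[OF d] sq_int_mult_integrable[OF u d] ud by simp
    finally have "(\<integral>x. (?u x)\<^sup>2 \<partial>T3) \<le> (\<integral>x. (f x - p x)\<^sup>2 \<partial>T3)" by simp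
    with p(2) show ?thesis by simp
  qed
  with K0 show ?thesis by (intro exI[of _ K0]) simp
qed

text \<open>All components of a field need the same frequency set. The union of their sets, joined
  with its negatives, is symmetric and still finite.\<close>

lemma fproj_approximates_family:
  fixes f :: "'i::finite \<Rightarrow> real^3 \<Rightarrow> real"
  assumes f: "\<And>j. sq_int (f j)" and e: "e > 0"
  obtains K where "finite K" "\<And>k. k \<in> K \<Longrightarrow> - k \<in> K"
    "\<forall>j. (\<integral>x. (f j x - fproj K (f j) x)\<^sup>2 \<partial>T3) < e"
proof -
  have "\<forall>j. \<exists>K0. finite K0 \<and> (\<forall>K. finite K \<and> K0 \<subseteq> K \<and> (\<forall>k\<in>K. - k \<in> K)
    \<longrightarrow> (\<integral>x. (f j x - fproj K (f j) x)\<^sup>2 \<partial>T3) < e)"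
    by (intro allI fproj_approximates f e)
  from choice[OF this] obtain K0 where
    K0: "\<forall>j. finite (K0 j) \<and> (\<forall>K. finite K \<and> K0 j \<subseteq> K \<and> (\<forall>k\<in>K. - k \<in> K)
    \<longrightarrow> (\<integral>x. (f j x - fproj K (f j) x)\<^sup>2 \<partial>T3) < e)" by (elim exE)
  let ?U = "\<Union>j. K0 j"
  let ?K = "?U \<union> uminus ` ?U"
  show ?thesis
  proof (rule that[of ?K])
    show fin: "finite ?K" using K0 by simp
    show sym: "- k \<in> ?K" if "k \<in> ?K" for k using that by auto
    show "\<forall>j. (\<integral>x. (f j x - fproj ?K (f j) x)\<^sup>2 \<partial>T3) < e"
      using fin sym by (intro allI K0[rule_format, THEN conjunct2, rule_format]) auto
  qed
qed

text \<open>Coefficients determine the norm, since up to any e it is the energy of a finite set.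
  This makes the norm of a weak gradient well defined.\<close>

lemma integral_sq_eq_of_coeffs:
  assumes f: "sq_int f" and g: "sq_int g"
    and eq: "\<And>k. fcos k f = fcos k g" "\<And>k. fsin k f = fsin k g"
  shows "(\<integral>x. (f x)\<^sup>2 \<partial>T3) = (\<integral>x. (g x)\<^sup>2 \<partial>T3)"
proof -
  have le: "(\<integral>x. (f x)\<^sup>2 \<partial>T3) \<le> (\<integral>x. (g x)\<^sup>2 \<partial>T3)"
    if f: "sq_int f" and g: "sq_int g"
      and eq: "\<And>k. fcos k f = fcos k g" "\<And>k. fsin k f = fsin k g" for f g
  proof (rule field_le_epsilon)
    fix e :: real assume e: "e > 0"
    obtain K where K: "finite K" "\<And>k. k \<in> K \<Longrightarrow> - k \<in> K"
      and less: "\<forall>j::unit. (\<integral>x. (f x - fproj K f x)\<^sup>2 \<partial>T3) < e"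
      by (rule fproj_approximates_family[of "\<lambda>_::unit. f", OF f e]) (rule that)
    have "energy K f = energy K g" by (simp add: energy_def eq)
    then show "(\<integral>x. (f x)\<^sup>2 \<partial>T3) \<le> (\<integral>x. (g x)\<^sup>2 \<partial>T3) + e"
      using fproj_pythagoras[OF f K] bessel[OF g K] less by simp
  qed
  show ?thesis using le[OF f g eq] le[OF g f eq[symmetric]] by (rule antisym)
qed

section \<open>Fourier projections of vector fields\<close>

lemma norm_vec_sq: "(norm x)\<^sup>2 = (\<Sum>i\<in>UNIV. (norm (x $ i))\<^sup>2)"
  by (simp add: norm_vec_def L2_set_def sum_nonneg)

lemma periodic_compose: "periodic f \<Longrightarrow> periodic (\<lambda>x. g (f x))"
  by (simp add: periodic_def)

text \<open>The component type is left general so that two applications reach the entries of a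
  matrix field.\<close>

lemma L2_vec_nth:
  fixes v :: "real^3 \<Rightarrow> 'a::euclidean_space^'n"
  assumes v: "v \<in> L2"
  shows "(\<lambda>x. v x $ j) \<in> L2"
proof -
  have "v \<in> borel_measurable T3" using v by (simp add: L2_def)
  then have m: "(\<lambda>x. v x $ j) \<in> borel_measurable T3"
    by (rule measurable_compose) (intro borel_measurable_continuous_onI continuous_intros)
  have "integrable T3 (\<lambda>x. (norm (v x $ j))\<^sup>2)"
  proof (rule Bochner_Integration.integrable_bound)
    show "integrable T3 (\<lambda>x. (norm (v x))\<^sup>2)" using v by (simp add: L2_def)
    show "(\<lambda>x. (norm (v x $ j))\<^sup>2) \<in> borel_measurable T3" using m by simp
    show "AE x in T3. norm ((norm (v x $ j))\<^sup>2) \<le> norm ((norm (v x))\<^sup>2)"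
      by (rule AE_I2) (simp add: power_mono Finite_Cartesian_Product.norm_nth_le)
  qed
  moreover have "periodic (\<lambda>x. v x $ j)"
    using v by (simp add: L2_def periodic_compose[of v "\<lambda>w. w $ j"])
  ultimately show ?thesis using m by (simp add: L2_def)
qed

lemma L2_sq_int: "f \<in> L2 \<Longrightarrow> sq_int f"
  by (simp add: L2_def sq_int_def)

lemma L2_component: "v \<in> L2 \<Longrightarrow> sq_int (\<lambda>x. v x $ j)"
  by (intro L2_sq_int L2_vec_nth)

lemma L2_component2: "G \<in> L2 \<Longrightarrow> sq_int (\<lambda>x. G x $ j $ i)"
  by (intro L2_sq_int L2_vec_nth)

lemma L2norm_sq: "(L2norm f)\<^sup>2 = (\<integral>x. (norm (f x))\<^sup>2 \<partial>T3)"
  by (simp add: L2norm_def)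

lemma L2norm_vec:
  fixes v :: "real^3 \<Rightarrow> real^'n"
  assumes "v \<in> L2"
  shows "(L2norm v)\<^sup>2 = (\<Sum>j\<in>UNIV. \<integral>x. (v x $ j)\<^sup>2 \<partial>T3)"
  unfolding L2norm_sq norm_vec_sq
  by (subst Bochner_Integration.integral_sum) (simp_all add: sq_int_integrable[OF L2_component[OF assms]])

lemma L2norm_mat:
  fixes G :: "real^3 \<Rightarrow> real^'n^'m"
  assumes "G \<in> L2"
  shows "(L2norm G)\<^sup>2 = (\<Sum>j\<in>UNIV. \<Sum>i\<in>UNIV. \<integral>x. (G x $ j $ i)\<^sup>2 \<partial>T3)"
  unfolding L2norm_sq norm_vec_sq
  by (simp add: sq_int_integrable[OF L2_component2[OF assms]])

lemma continuous_L2: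
  fixes f :: "real^3 \<Rightarrow> 'a::euclidean_space"
  assumes "periodic f" "continuous_on UNIV f"
  shows "f \<in> L2"
  unfolding L2_def using assms
  by (auto intro!: continuous_imp_borel_measurable_T3 continuous_imp_integrable_T3 continuous_intros)

lemma periodic_fproj: "periodic (fproj K f)"
  unfolding periodic_def
proof (intro allI impI)
  fix x m :: "real^3" assume m: "\<forall>i. m $ i \<in> \<int>"
  show "fproj K f (x + m) = fproj K f x"
    unfolding fproj_def
    by (intro sum.cong refl) (use m periodic_trig in \<open>auto simp: periodic_def\<close>)
qed

lemma continuous_fproj: "continuous_on S (fproj K f)"
  unfolding fproj_def[abs_def] by (intro continuous_intros)

section \<open>Projected fields, their weak gradient, divergence and mean\<close>

definition vproj :: "(int^3) set \<Rightarrow> (real^3 \<Rightarrow> real^3) \<Rightarrow> real^3 \<Rightarrow> real^3" where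
  "vproj K v x = (\<chi> j. fproj K (\<lambda>y. v y $ j) x)"

definition gproj :: "(int^3) set \<Rightarrow> (real^3 \<Rightarrow> real^3^3) \<Rightarrow> real^3 \<Rightarrow> real^3^3" where
  "gproj K G x = (\<chi> j i. fproj K (\<lambda>y. G y $ j $ i) x)"

lemma vproj_nth [simp]: "vproj K v x $ j = fproj K (\<lambda>y. v y $ j) x"
  and gproj_nth [simp]: "gproj K G x $ j $ i = fproj K (\<lambda>y. G y $ j $ i) x"
  by (simp_all add: vproj_def gproj_def)

lemma vproj_L2: "vproj K v \<in> L2"
proof (rule continuous_L2)
  show "periodic (vproj K v)"
    using periodic_fproj[of K] by (simp add: periodic_def vec_eq_iff)
  show "continuous_on UNIV (vproj K v)"
    unfolding vproj_def[abs_def] by (intro continuous_intros continuous_fproj)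
qed

lemma gproj_L2: "gproj K G \<in> L2"
proof (rule continuous_L2)
  show "periodic (gproj K G)"
    using periodic_fproj[of K] by (simp add: periodic_def vec_eq_iff)
  show "continuous_on UNIV (gproj K G)"
    unfolding gproj_def[abs_def] by (intro continuous_intros continuous_fproj)
qed

lemma test_function_trig: "cosm k \<in> test_functions" "sinm k \<in> test_functions"
  using trig_test_function[of 1 k 0] trig_test_function[of 0 k 1] by simp_all

lemma partial_deriv_modes:
  "partial_deriv i (cosm k) = (\<lambda>x. - (2 * pi * real_of_int (k $ i)) * sinm k x)"
  "partial_deriv i (sinm k) = (\<lambda>x. 2 * pi * real_of_int (k $ i) * cosm k x)"
  using partial_deriv_trig[of i 1 k 0] partial_deriv_trig[of i 0 k 1] by simp_all

text \<open>Testing with the modes gives the real form of the rule that differentiation multiplies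
  the coefficient at k by 2 \<pi> i times a component of k.\<close>

lemma coeffs_weak_gradient:
  assumes "is_weak_gradient v G"
  shows "fcos k (\<lambda>x. G x $ j $ i) = 2 * pi * real_of_int (k $ i) * fsin k (\<lambda>x. v x $ j)"
    and "fsin k (\<lambda>x. G x $ j $ i) = - (2 * pi * real_of_int (k $ i)) * fcos k (\<lambda>x. v x $ j)"
proof -
  have *: "(\<integral>x. v x $ j * partial_deriv i \<phi> x \<partial>T3) = - (\<integral>x. G x $ j $ i * \<phi> x \<partial>T3)"
    if "\<phi> \<in> test_functions" for \<phi>
    using assms that by (simp add: is_weak_gradient_def)
  have "(\<integral>x. - (2 * pi * real_of_int (k $ i)) * (v x $ j * sinm k x) \<partial>T3) = - fcos k (\<lambda>x. G x $ j $ i)"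
    using *[OF test_function_trig(1)[of k]] by (simp add: partial_deriv_modes fcos_def mult.left_commute)
  then show "fcos k (\<lambda>x. G x $ j $ i) = 2 * pi * real_of_int (k $ i) * fsin k (\<lambda>x. v x $ j)"
    by (simp add: fsin_def)
  have "(\<integral>x. 2 * pi * real_of_int (k $ i) * (v x $ j * cosm k x) \<partial>T3) = - fsin k (\<lambda>x. G x $ j $ i)"
    using *[OF test_function_trig(2)[of k]] by (simp add: partial_deriv_modes fsin_def mult.left_commute)
  then show "fsin k (\<lambda>x. G x $ j $ i) = - (2 * pi * real_of_int (k $ i)) * fcos k (\<lambda>x. v x $ j)"
    by (simp add: fcos_def)
qed

text \<open>The coefficients of a weak gradient are determined by \<open>v\<close>, and they
  determine its norm. Hence the representative chosen in \<open>weak_gradient\<close> does not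
  affect the norms.\<close>

lemma weak_gradient_L2norm_unique:
  assumes G: "is_weak_gradient v G" and G': "is_weak_gradient v G'"
  shows "L2norm G = L2norm G'"
proof -
  have L: "G \<in> L2" "G' \<in> L2" using G G' by (simp_all add: is_weak_gradient_def)
  have "(\<integral>x. (G x $ j $ i)\<^sup>2 \<partial>T3) = (\<integral>x. (G' x $ j $ i)\<^sup>2 \<partial>T3)" for i j
    by (rule integral_sq_eq_of_coeffs[OF L2_component2[OF L(1)] L2_component2[OF L(2)]])
      (simp_all only: coeffs_weak_gradient[OF G] coeffs_weak_gradient[OF G'])
  then have "(L2norm G)\<^sup>2 = (L2norm G')\<^sup>2" by (simp add: L2norm_mat[OF L(1)] L2norm_mat[OF L(2)])
  then show ?thesis by (simp add: L2norm_def)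
qed

lemma is_weak_gradient_choice: "is_weak_gradient v G \<Longrightarrow> is_weak_gradient v (weak_gradient v)"
  unfolding weak_gradient_def by (rule someI[of "is_weak_gradient v"])

text \<open>The classical derivative of each mode of the projected \<open>v\<close> is the
  corresponding mode of the projected \<open>G\<close>, so integration by parts applies frequency by
  frequency.\<close>

lemma integral_fproj_partial_deriv:
  assumes G: "is_weak_gradient v G" and \<phi>: "\<phi> \<in> test_functions" and K: "finite K"
  shows "(\<integral>x. fproj K (\<lambda>y. v y $ j) x * partial_deriv i \<phi> x \<partial>T3)
    = - (\<integral>x. fproj K (\<lambda>y. G y $ j $ i) x * \<phi> x \<partial>T3)"
proof -
  let ?c = "\<lambda>k. fcos k (\<lambda>y. v y $ j)" and ?s = "\<lambda>k. fsin k (\<lambda>y. v y $ j)"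
  let ?m = "\<lambda>k x. ?c k * cosm k x + ?s k * sinm k x"
  let ?n = "\<lambda>k x. fcos k (\<lambda>y. G y $ j $ i) * cosm k x + fsin k (\<lambda>y. G y $ j $ i) * sinm k x"
  note c\<phi> = test_functionD(3)[OF \<phi>] test_functionD(4)[OF \<phi>, of i]
  have n: "?n k = partial_deriv i (?m k)" for k
    by (simp add: partial_deriv_trig coeffs_weak_gradient[OF G])
  have int: "integrable T3 (\<lambda>x. ?m k x * partial_deriv i \<phi> x)" "integrable T3 (\<lambda>x. ?n k x * \<phi> x)" for k
    by (rule continuous_imp_integrable_T3, intro continuous_intros c\<phi>)+
  have "(\<integral>x. fproj K (\<lambda>y. v y $ j) x * partial_deriv i \<phi> x \<partial>T3) = (\<integral>x. (\<Sum>k\<in>K. ?m k x * partial_deriv i \<phi> x) \<partial>T3)"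
    by (simp only: fproj_def sum_distrib_right)
  also have "\<dots> = (\<Sum>k\<in>K. \<integral>x. ?m k x * partial_deriv i \<phi> x \<partial>T3)"
    by (rule Bochner_Integration.integral_sum) (rule int)
  also have "\<dots> = (\<Sum>k\<in>K. - (\<integral>x. ?n k x * \<phi> x \<partial>T3))"
    using integration_by_parts_T3[OF trig_test_function \<phi>, of "?c k" k "?s k" i for k]
    by (simp only: n[symmetric])
  also have "\<dots> = - (\<integral>x. (\<Sum>k\<in>K. ?n k x * \<phi> x) \<partial>T3)"
    by (subst Bochner_Integration.integral_sum) (simp_all only: int sum_negf)
  also have "(\<integral>x. (\<Sum>k\<in>K. ?n k x * \<phi> x) \<partial>T3) = (\<integral>x. fproj K (\<lambda>y. G y $ j $ i) x * \<phi> x \<partial>T3)"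
    by (simp only: fproj_def sum_distrib_right)
  finally show ?thesis .
qed

lemma weak_gradient_vproj:
  assumes "is_weak_gradient v G" "finite K"
  shows "is_weak_gradient (vproj K v) (gproj K G)"
  unfolding is_weak_gradient_def using integral_fproj_partial_deriv[OF assms(1) _ assms(2)] gproj_L2
  by simp

text \<open>Testing the divergence condition with modes says that the coefficient vector at k is
  orthogonal to k; in terms of \<open>G\<close>, its trace has vanishing coefficients.\<close>

lemma coeffs_div_free:
  assumes v: "v \<in> L2" and div: "div_free v" and G: "is_weak_gradient v G"
  shows "(\<Sum>i\<in>UNIV. fcos k (\<lambda>x. G x $ i $ i)) = 0" "(\<Sum>i\<in>UNIV. fsin k (\<lambda>x. G x $ i $ i)) = 0"
proof -
  note int = integrable_mult_trig[OF L2_component[OF v]]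
  have "0 = (\<integral>x. (\<Sum>i\<in>UNIV. - (2 * pi * real_of_int (k $ i)) * (v x $ i * sinm k x)) \<partial>T3)"
    using div[unfolded div_free_def, rule_format, OF test_function_trig(1)[of k]]
    by (simp add: partial_deriv_modes mult.left_commute)
  also have "\<dots> = - (\<Sum>i\<in>UNIV. fcos k (\<lambda>x. G x $ i $ i))"
    using int by (simp add: coeffs_weak_gradient[OF G] fsin_def sum_negf)
  finally show "(\<Sum>i\<in>UNIV. fcos k (\<lambda>x. G x $ i $ i)) = 0" by simp
  have "0 = (\<integral>x. (\<Sum>i\<in>UNIV. 2 * pi * real_of_int (k $ i) * (v x $ i * cosm k x)) \<partial>T3)"
    using div[unfolded div_free_def, rule_format, OF test_function_trig(2)[of k]]
    by (simp add: partial_deriv_modes mult.left_commute)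
  also have "\<dots> = - (\<Sum>i\<in>UNIV. fsin k (\<lambda>x. G x $ i $ i))"
    using int by (simp add: coeffs_weak_gradient[OF G] fcos_def sum_negf)
  finally show "(\<Sum>i\<in>UNIV. fsin k (\<lambda>x. G x $ i $ i)) = 0" by simp
qed

lemma div_free_vproj:
  assumes v: "v \<in> L2" and div: "div_free v" and G: "is_weak_gradient v G" and K: "finite K"
  shows "div_free (vproj K v)"
  unfolding div_free_def
proof
  fix \<phi> assume \<phi>: "\<phi> \<in> test_functions"
  note c\<phi> = test_functionD(3)[OF \<phi>] test_functionD(4)[OF \<phi>]
  have int: "integrable T3 (\<lambda>x. fproj K f x * partial_deriv i \<phi> x)" "integrable T3 (\<lambda>x. fproj K f x * \<phi> x)" for f i
    by (rule continuous_imp_integrable_T3, intro continuous_intros c\<phi> continuous_fproj)+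
  \<comment> \<open>Integration by parts moves the derivative from \<phi> to the field and produces
    the trace of the projected gradient, which vanishes pointwise.\<close>
  have tr: "(\<Sum>i\<in>UNIV. fproj K (\<lambda>y. G y $ i $ i) x) = 0" for x
    unfolding fproj_def
    by (subst sum.swap) (simp add: sum.distrib coeffs_div_free[OF v div G] flip: sum_distrib_right)
  have "(\<integral>x. (\<Sum>i\<in>UNIV. vproj K v x $ i * partial_deriv i \<phi> x) \<partial>T3)
     = (\<Sum>i\<in>UNIV. \<integral>x. fproj K (\<lambda>y. v y $ i) x * partial_deriv i \<phi> x \<partial>T3)"
    unfolding vproj_nth by (rule Bochner_Integration.integral_sum) (rule int)
  also have "\<dots> = - (\<Sum>i\<in>UNIV. \<integral>x. fproj K (\<lambda>y. G y $ i $ i) x * \<phi> x \<partial>T3)"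
    by (simp only: integral_fproj_partial_deriv[OF G \<phi> K] sum_negf)
  also have "(\<Sum>i\<in>UNIV. \<integral>x. fproj K (\<lambda>y. G y $ i $ i) x * \<phi> x \<partial>T3)
     = (\<integral>x. (\<Sum>i\<in>UNIV. fproj K (\<lambda>y. G y $ i $ i) x) * \<phi> x \<partial>T3)"
    unfolding sum_distrib_right by (rule Bochner_Integration.integral_sum[symmetric]) (rule int)
  also have "\<dots> = 0" unfolding tr by simp
  finally show "(\<integral>x. (\<Sum>i\<in>UNIV. vproj K v x $ i * partial_deriv i \<phi> x) \<partial>T3) = 0" by simp
qed

lemma integrable_L2:
  fixes v :: "real^3 \<Rightarrow> 'a::euclidean_space"
  assumes "v \<in> L2"
  shows "integrable T3 v"
proof (rule Bochner_Integration.integrable_bound)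
  show "integrable T3 (\<lambda>x. 1 + (norm (v x))\<^sup>2)"
    using assms continuous_imp_integrable_T3[of "\<lambda>_. 1::real"] by (simp add: L2_def)
  show "v \<in> borel_measurable T3" using assms by (simp add: L2_def)
  have "a \<le> 1 + a\<^sup>2" for a :: real
    using sum_squares_bound[of a 1] zero_le_power2[of a] by (simp only: power_one)
  then show "AE x in T3. norm (v x) \<le> norm (1 + (norm (v x))\<^sup>2)" by simp
qed

lemma integral_vec_nth:
  fixes v :: "real^3 \<Rightarrow> real^3"
  assumes "v \<in> L2"
  shows "(\<integral>x. v x \<partial>T3) $ j = (\<integral>x. v x $ j \<partial>T3)"
  using integral_bounded_linear[OF bounded_linear_vec_nth integrable_L2[OF assms]] by simp

lemma coeffs_0: "fcos 0 f = integral\<^sup>L T3 f" "fsin 0 f = 0"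
  by (simp_all add: fcos_def fsin_def)

text \<open>Only the zero frequency has a nonzero integral, and its coefficient is the mean of
  \<open>v\<close>.\<close>

lemma mean_vproj:
  assumes v: "v \<in> L2" and mean: "(\<integral>x. v x \<partial>T3) = 0" and K: "finite K"
  shows "(\<integral>x. vproj K v x \<partial>T3) = 0"
proof -
  have "(\<integral>x. fproj K (\<lambda>y. v y $ j) x \<partial>T3) = 0" for j
  proof -
    have m: "fcos 0 (\<lambda>y. v y $ j) = 0"
      using integral_vec_nth[OF v, of j] mean by (simp add: coeffs_0)
    have "(\<integral>x. fproj K (\<lambda>y. v y $ j) x \<partial>T3) = (\<Sum>k\<in>K. fcos k (\<lambda>y. v y $ j) * (if k = 0 then 1 else 0))"
      unfolding fproj_def by (simp add: integral_trig)
    also have "\<dots> = 0" by (rule sum.neutral) (simp add: m)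
    finally show ?thesis .
  qed
  then show ?thesis by (simp add: vec_eq_iff integral_vec_nth[OF vproj_L2])
qed

lemma fourier_mode_eq: "fourier_mode k x = Complex (cosm k x) (sinm k x)"
proof -
  have "2 * complex_of_real pi * \<i> * complex_of_real (\<Sum>i\<in>UNIV. real_of_int (k $ i) * x $ i)
      = \<i> * complex_of_real (phase k x)"
    by (simp add: phase_def)
  then have "fourier_mode k x = cis (phase k x)"
    by (simp only: fourier_mode_def cis_conv_exp)
  then show ?thesis by (simp add: complex_eq_iff)
qed

lemma trig_poly_vproj:
  assumes K: "finite K" and sym: "\<And>k. k \<in> K \<Longrightarrow> - k \<in> K"
  shows "trig_poly (vproj K v)"
  unfolding trig_poly_def
proof (intro exI conjI allI)
  let ?c = "\<lambda>k. (\<chi> j. Complex (fcos k (\<lambda>y. v y $ j)) (- fsin k (\<lambda>y. v y $ j))) :: complex^3"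
  show "finite K" by fact
  fix x j
  let ?a = "\<lambda>k. fcos k (\<lambda>y. v y $ j)" and ?b = "\<lambda>k. fsin k (\<lambda>y. v y $ j)"
  \<comment> \<open>The imaginary part of the term at k. It is odd in k, so it cancels over the
    symmetric set and the field is real.\<close>
  let ?h = "\<lambda>k. ?a k * sinm k x - ?b k * cosm k x"
  have bij: "bij_betw uminus K K"
    by (rule bij_betw_byWitness[where f' = uminus]) (use sym in auto)
  have "sum ?h K = (\<Sum>k\<in>K. ?h (- k))"
    by (rule sum.reindex_bij_betw[OF bij, symmetric])
  also have "\<dots> = - sum ?h K" by (simp add: phase_minus sum_negf[symmetric] algebra_simps)
  finally have im: "sum ?h K = 0" by simp
  show "complex_of_real (vproj K v x $ j) = (\<Sum>k\<in>K. ?c k $ j * fourier_mode k x)"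
  proof (rule complex_eqI)
    show "Re (complex_of_real (vproj K v x $ j)) = Re (\<Sum>k\<in>K. ?c k $ j * fourier_mode k x)"
      by (simp add: fourier_mode_eq fproj_def)
    show "Im (complex_of_real (vproj K v x $ j)) = Im (\<Sum>k\<in>K. ?c k $ j * fourier_mode k x)"
      using im by (simp add: fourier_mode_eq)
  qed
qed

lemma vproj_H_space:
  assumes v: "v \<in> V_space" and K: "finite K"
  shows "vproj K v \<in> H_space"
  using v vproj_L2 div_free_vproj[OF _ _ _ K] mean_vproj[OF _ _ K]
  unfolding V_space_def H_space_def H1_def by blast

section \<open>The damping inequality\<close>

text \<open>The error e / 3 is spent on each of the three components. The second bound is Pythagoras
  and keeps the factor 1 in front of the projected norm.\<close>

lemma V_space_approx:
  assumes v: "v \<in> V_space" and e: "e > 0"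
  obtains K where "finite K" "\<And>k. k \<in> K \<Longrightarrow> - k \<in> K"
    "(L2norm (\<lambda>x. v x - vproj K v x))\<^sup>2 \<le> e"
    "(L2norm v)\<^sup>2 \<le> (L2norm (vproj K v))\<^sup>2 + e"
proof -
  have L: "v \<in> L2" using v by (simp add: V_space_def H_space_def)
  note sq = L2_component[OF L]
  have e3: "e / 3 > 0" using e by simp
  obtain K where K: "finite K" "\<And>k. k \<in> K \<Longrightarrow> - k \<in> K"
    and less: "\<forall>j. (\<integral>x. (v x $ j - fproj K (\<lambda>x. v x $ j) x)\<^sup>2 \<partial>T3) < e / 3"
    by (rule fproj_approximates_family[of "\<lambda>j x. v x $ j", OF sq e3]) (rule that)
  have "(L2norm (\<lambda>x. v x - vproj K v x))\<^sup>2 = (\<Sum>j\<in>UNIV. \<integral>x. (v x $ j - fproj K (\<lambda>x. v x $ j) x)\<^sup>2 \<partial>T3)"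
    unfolding L2norm_sq norm_vec_sq
    by (subst Bochner_Integration.integral_sum)
      (simp_all add: sq_int_integrable[OF sq_int_diff[OF sq sq_int_fproj[OF K(1)]]])
  also have "\<dots> \<le> (\<Sum>j\<in>(UNIV :: 3 set). e / 3)"
    using less by (intro sum_mono less_imp_le) simp
  finally have 1: "(L2norm (\<lambda>x. v x - vproj K v x))\<^sup>2 \<le> e" by simp
  have "(L2norm v)\<^sup>2 = (\<Sum>j\<in>UNIV. (\<integral>x. (v x $ j - fproj K (\<lambda>x. v x $ j) x)\<^sup>2 \<partial>T3) + energy K (\<lambda>x. v x $ j))"
    by (simp add: L2norm_vec[OF L] fproj_pythagoras[OF sq K])
  also have "\<dots> \<le> (\<Sum>j\<in>UNIV. e / 3 + energy K (\<lambda>x. v x $ j))"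
    using less by (intro sum_mono add_mono less_imp_le) simp_all
  also have "\<dots> = (L2norm (vproj K v))\<^sup>2 + e"
    by (simp add: L2norm_vec[OF vproj_L2] integral_fproj_sq[OF K] sum.distrib)
  finally have 2: "(L2norm v)\<^sup>2 \<le> (L2norm (vproj K v))\<^sup>2 + e" .
  show ?thesis by (rule that[OF K 1 2])
qed

lemma V_space_weak_gradient: "v \<in> V_space \<Longrightarrow> is_weak_gradient v (weak_gradient v)"
  unfolding V_space_def H1_def using is_weak_gradient_choice by blast

text \<open>The gradient of the projection has the norm of the projected gradient, to which Bessel
  applies entrywise.\<close>

lemma weak_gradient_vproj_le:
  assumes v: "v \<in> V_space" and K: "finite K" "\<And>k. k \<in> K \<Longrightarrow> - k \<in> K"
  shows "(L2norm (weak_gradient (vproj K v)))\<^sup>2 \<le> (L2norm (weak_gradient v))\<^sup>2"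
proof -
  let ?G = "weak_gradient v"
  have G: "is_weak_gradient v ?G" by (rule V_space_weak_gradient[OF v])
  then have L: "?G \<in> L2" by (simp add: is_weak_gradient_def)
  have P: "is_weak_gradient (vproj K v) (gproj K ?G)" by (rule weak_gradient_vproj[OF G K(1)])
  have "(L2norm (weak_gradient (vproj K v)))\<^sup>2 = (L2norm (gproj K ?G))\<^sup>2"
    using weak_gradient_L2norm_unique[OF is_weak_gradient_choice[OF P] P] by simp
  also have "\<dots> = (\<Sum>j\<in>UNIV. \<Sum>i\<in>UNIV. energy K (\<lambda>x. ?G x $ j $ i))"
    by (simp add: L2norm_mat[OF gproj_L2] integral_fproj_sq[OF K])
  also have "\<dots> \<le> (L2norm ?G)\<^sup>2"
    unfolding L2norm_mat[OF L] by (intro sum_mono bessel[OF L2_component2[OF L] K])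
  finally show ?thesis .
qed

lemma poincare:
  assumes v: "v \<in> V_space"
  shows "(L2norm v)\<^sup>2 \<le> (L2norm (weak_gradient v))\<^sup>2"
proof (rule field_le_epsilon)
  fix e :: real assume e: "e > 0"
  let ?G = "weak_gradient v"
  have G: "is_weak_gradient v ?G" by (rule V_space_weak_gradient[OF v])
  then have LG: "?G \<in> L2" by (simp add: is_weak_gradient_def)
  have L: "v \<in> L2" and mean: "(\<integral>x. v x \<partial>T3) = 0" using v by (simp_all add: V_space_def H_space_def)
  obtain K where K: "finite K" "\<And>k. k \<in> K \<Longrightarrow> - k \<in> K"
    and le: "(L2norm v)\<^sup>2 \<le> (L2norm (vproj K v))\<^sup>2 + e"
    by (rule V_space_approx[OF v e]) (rule that)
  \<comment> \<open>At k = 0 the left side vanishes by mean zero. Otherwise some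
    \<open>k $ i\<close> is a nonzero integer, and the corresponding derivative alone multiplies the
    mode by at least 2 \<pi>, more than the 1 that is needed.\<close>
  have mode: "(fcos k (\<lambda>x. v x $ j))\<^sup>2 + (fsin k (\<lambda>x. v x $ j))\<^sup>2
     \<le> (\<Sum>i\<in>UNIV. (fcos k (\<lambda>x. ?G x $ j $ i))\<^sup>2 + (fsin k (\<lambda>x. ?G x $ j $ i))\<^sup>2)" for j k
  proof (cases "k = 0")
    case True
    have "fcos 0 (\<lambda>x. v x $ j) = 0" "fsin 0 (\<lambda>x. v x $ j) = 0"
      using integral_vec_nth[OF L, of j] mean by (simp_all add: coeffs_0)
    then show ?thesis unfolding True by (simp add: sum_nonneg)
  next
    case False
    then obtain i where i: "k $ i \<noteq> 0" by (auto simp: vec_eq_iff)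
    let ?m = "2 * pi * real_of_int (k $ i)" and ?a = "fcos k (\<lambda>x. v x $ j)" and ?b = "fsin k (\<lambda>x. v x $ j)"
    have "1 \<le> \<bar>real_of_int (k $ i)\<bar>" using i by linarith
    moreover have "1 \<le> 2 * pi" using pi_ge_two by linarith
    ultimately have "1 * 1 \<le> (2 * pi) * \<bar>real_of_int (k $ i)\<bar>" by (intro mult_mono) auto
    then have "1 \<le> \<bar>?m\<bar>" by (simp add: abs_mult)
    then have m: "1 \<le> ?m\<^sup>2" by (metis one_power2 power2_abs power_mono zero_le_one)
    have "1 * (?a\<^sup>2 + ?b\<^sup>2) \<le> ?m\<^sup>2 * (?a\<^sup>2 + ?b\<^sup>2)" by (rule mult_right_mono[OF m]) simp
    also have "\<dots> = (fcos k (\<lambda>x. ?G x $ j $ i))\<^sup>2 + (fsin k (\<lambda>x. ?G x $ j $ i))\<^sup>2"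
      by (simp add: coeffs_weak_gradient[OF G] power_mult_distrib algebra_simps)
    also have "\<dots> \<le> (\<Sum>i\<in>UNIV. (fcos k (\<lambda>x. ?G x $ j $ i))\<^sup>2 + (fsin k (\<lambda>x. ?G x $ j $ i))\<^sup>2)"
      by (rule member_le_sum) auto
    finally show ?thesis by simp
  qed
  have "(L2norm (vproj K v))\<^sup>2 = (\<Sum>j\<in>UNIV. energy K (\<lambda>x. v x $ j))"
    by (simp add: L2norm_vec[OF vproj_L2] integral_fproj_sq[OF K])
  also have "\<dots> \<le> (\<Sum>j\<in>UNIV. \<Sum>k\<in>K. \<Sum>i\<in>UNIV. (fcos k (\<lambda>x. ?G x $ j $ i))\<^sup>2 + (fsin k (\<lambda>x. ?G x $ j $ i))\<^sup>2)"
    unfolding energy_def by (intro sum_mono mode)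
  also have "\<dots> = (\<Sum>j\<in>UNIV. \<Sum>i\<in>UNIV. energy K (\<lambda>x. ?G x $ j $ i))"
    unfolding energy_def by (rule sum.cong[OF refl], rule sum.swap)
  also have "\<dots> \<le> (L2norm ?G)\<^sup>2"
    unfolding L2norm_mat[OF LG] by (intro sum_mono bessel[OF L2_component2[OF LG] K])
  finally show "(L2norm v)\<^sup>2 \<le> (L2norm ?G)\<^sup>2 + e" using le by simp
qed

section \<open>Passing from trigonometric polynomials to the whole space\<close>

lemma le_of_le_add_mult_epsilon:
  fixes a b c :: real
  assumes "\<And>e. e > 0 \<Longrightarrow> a \<le> b + c * e"
  shows "a \<le> b"
proof (rule field_le_epsilon)
  fix e :: real assume e: "e > 0"
  have "c * (e / (\<bar>c\<bar> + 1)) \<le> \<bar>c\<bar> * (e / (\<bar>c\<bar> + 1))" using e by (intro mult_right_mono) auto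
  also have "\<dots> \<le> e" using e by (simp add: field_simps)
  finally show "a \<le> b + e" using assms[of "e / (\<bar>c\<bar> + 1)"] e by simp
qed

text \<open>Young's inequality with a parameter: the factor of the first term can be brought
  arbitrarily close to 1, so that the constant of the assumed inequality survives the limit.\<close>

lemma norm_add_sq_le:
  fixes a b :: "'a::real_inner"
  assumes d: "d > 0"
  shows "(norm (a + b))\<^sup>2 \<le> (1 + d) * (norm a)\<^sup>2 + (1 + 1 / d) * (norm b)\<^sup>2"
proof -
  have "0 \<le> (sqrt d * norm a - norm b / sqrt d)\<^sup>2" by simp
  also have "\<dots> = d * (norm a)\<^sup>2 - 2 * (norm a * norm b) + (norm b)\<^sup>2 / d"
    using d by (simp add: power2_diff power_mult_distrib power_divide)
  finally have "2 * (norm a * norm b) \<le> d * (norm a)\<^sup>2 + (norm b)\<^sup>2 / d" by simp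
  moreover have "(norm (a + b))\<^sup>2 \<le> (norm a + norm b)\<^sup>2"
    by (intro power_mono norm_triangle_ineq) simp
  ultimately show ?thesis by (simp add: power2_sum algebra_simps)
qed

lemma weighted_bound:
  fixes w :: "real^3 \<Rightarrow> real^3"
  assumes chi: "\<rho> \<in> borel_measurable T3" "AE x in T3. 0 \<le> \<rho> x" "AE x in T3. \<rho> x \<le> M"
    and w: "w \<in> borel_measurable T3" "integrable T3 (\<lambda>x. (norm (w x))\<^sup>2)"
  shows "integrable T3 (\<lambda>x. (norm (sqrt (\<rho> x) *\<^sub>R w x))\<^sup>2)"
    and "(L2norm (\<lambda>x. sqrt (\<rho> x) *\<^sub>R w x))\<^sup>2 \<le> M * (L2norm w)\<^sup>2"
proof -
  have le: "AE x in T3. (norm (sqrt (\<rho> x) *\<^sub>R w x))\<^sup>2 \<le> M * (norm (w x))\<^sup>2"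
    using chi(2,3)
  proof eventually_elim
    case (elim x)
    then show ?case by (simp add: power_mult_distrib mult_right_mono)
  qed
  have m: "(\<lambda>x. (norm (sqrt (\<rho> x) *\<^sub>R w x))\<^sup>2) \<in> borel_measurable T3"
    using chi(1) w(1) by measurable
  have i: "integrable T3 (\<lambda>x. M * (norm (w x))\<^sup>2)" using w(2) by simp
  show I: "integrable T3 (\<lambda>x. (norm (sqrt (\<rho> x) *\<^sub>R w x))\<^sup>2)"
    by (rule Bochner_Integration.integrable_bound[OF i m]) (use le in \<open>auto elim!: eventually_mono\<close>)
  show "(L2norm (\<lambda>x. sqrt (\<rho> x) *\<^sub>R w x))\<^sup>2 \<le> M * (L2norm w)\<^sup>2"
    unfolding L2norm_sq using integral_mono_AE[OF I i le] by simp
qed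

text \<open>The inequality is applied to projections of \<open>v\<close>. Weighted norms of
  projection and field are compared by Young's inequality, and the weighted error is controlled by
  the bound on \<open>\<rho>\<close>.\<close>

lemma observability_V_space:
  fixes C :: real
  assumes chi: "\<rho> \<in> Linfty" "AE x in T3. \<rho> x \<ge> 0" and C: "C > 0"
    and obs: "\<And>v. v \<in> H_space \<Longrightarrow> trig_poly v \<Longrightarrow>
      (L2norm v)\<^sup>2 \<le> C * ((L2norm (\<lambda>x. sqrt (\<rho> x) *\<^sub>R v x))\<^sup>2 + (L2norm (weak_gradient v))\<^sup>2)"
    and v: "v \<in> V_space"
  shows "(L2norm v)\<^sup>2 \<le> C * ((L2norm (\<lambda>x. sqrt (\<rho> x) *\<^sub>R v x))\<^sup>2 + (L2norm (weak_gradient v))\<^sup>2)"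
proof -
  let ?N = "\<lambda>w. (L2norm (\<lambda>x. sqrt (\<rho> x) *\<^sub>R w x))\<^sup>2" and ?D = "(L2norm (weak_gradient v))\<^sup>2"
  obtain M where M: "AE x in T3. \<bar>\<rho> x\<bar> \<le> M" using chi(1) by (auto simp: Linfty_def)
  \<comment> \<open>Taking the maximum with 0 makes the bound nonnegative without further argument,
    as the monotonicity of multiplication by it requires.\<close>
  have "AE x in T3. \<rho> x \<le> max M 0" using M by eventually_elim auto
  then have chi': "\<rho> \<in> borel_measurable T3" "AE x in T3. 0 \<le> \<rho> x" "AE x in T3. \<rho> x \<le> max M 0"
    using chi by (simp_all add: Linfty_def)
  let ?M = "max M 0"
  have L: "v \<in> L2" using v by (simp add: V_space_def H_space_def)
  have mv: "v \<in> borel_measurable T3" and iv: "integrable T3 (\<lambda>x. (norm (v x))\<^sup>2)"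
    using L by (simp_all add: L2_def)
  have key: "(L2norm v)\<^sup>2 \<le> (C * ((1 + d) * ?N v + ?D)) + (1 + C * (1 + 1 / d) * ?M) * e"
    if d: "d > 0" and e: "e > 0" for d e
  proof -
    obtain K where K: "finite K" "\<And>k. k \<in> K \<Longrightarrow> - k \<in> K"
      and less: "(L2norm (\<lambda>x. v x - vproj K v x))\<^sup>2 \<le> e"
      and le: "(L2norm v)\<^sup>2 \<le> (L2norm (vproj K v))\<^sup>2 + e"
      by (rule V_space_approx[OF v e]) (rule that)
    let ?p = "vproj K v" and ?r = "\<lambda>x. vproj K v x - v x"
    have mp: "?p \<in> borel_measurable T3" and ip: "integrable T3 (\<lambda>x. (norm (?p x))\<^sup>2)"
      using vproj_L2[of K v] by (simp_all add: L2_def)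
    have mr: "?r \<in> borel_measurable T3" using mp mv by simp
    have ir: "integrable T3 (\<lambda>x. (norm (?r x))\<^sup>2)"
      unfolding norm_vec_sq vector_minus_component vproj_nth real_norm_def power2_abs
      by (intro Bochner_Integration.integrable_sum sq_int_integrable sq_int_diff sq_int_fproj[OF K(1)] L2_component[OF L])
    have r: "(L2norm ?r)\<^sup>2 \<le> e" using less by (simp add: L2norm_sq norm_minus_commute)
    have "?N ?p \<le> (1 + d) * ?N v + (1 + 1 / d) * ?N ?r"
    proof -
      note I = weighted_bound(1)[OF chi' mp ip] weighted_bound(1)[OF chi' mv iv] weighted_bound(1)[OF chi' mr ir]
      have "(\<integral>x. (norm (sqrt (\<rho> x) *\<^sub>R ?p x))\<^sup>2 \<partial>T3)
        \<le> (\<integral>x. (1 + d) * (norm (sqrt (\<rho> x) *\<^sub>R v x))\<^sup>2 + (1 + 1 / d) * (norm (sqrt (\<rho> x) *\<^sub>R ?r x))\<^sup>2 \<partial>T3)"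
      proof (rule integral_mono)
        show "integrable T3 (\<lambda>x. (norm (sqrt (\<rho> x) *\<^sub>R ?p x))\<^sup>2)" by (rule I)
        show "integrable T3 (\<lambda>x. (1 + d) * (norm (sqrt (\<rho> x) *\<^sub>R v x))\<^sup>2 + (1 + 1 / d) * (norm (sqrt (\<rho> x) *\<^sub>R ?r x))\<^sup>2)"
          by (intro Bochner_Integration.integrable_add integrable_mult_right I)
        fix x
        show "(norm (sqrt (\<rho> x) *\<^sub>R ?p x))\<^sup>2
          \<le> (1 + d) * (norm (sqrt (\<rho> x) *\<^sub>R v x))\<^sup>2 + (1 + 1 / d) * (norm (sqrt (\<rho> x) *\<^sub>R ?r x))\<^sup>2"
          using norm_add_sq_le[OF d, of "sqrt (\<rho> x) *\<^sub>R v x" "sqrt (\<rho> x) *\<^sub>R ?r x"]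
          by (simp only: scaleR_add_right[symmetric] add_diff_cancel_left' diff_add_cancel add.commute[of "v x"])
      qed
      also have "\<dots> = (1 + d) * (\<integral>x. (norm (sqrt (\<rho> x) *\<^sub>R v x))\<^sup>2 \<partial>T3)
          + (1 + 1 / d) * (\<integral>x. (norm (sqrt (\<rho> x) *\<^sub>R ?r x))\<^sup>2 \<partial>T3)"
        by (subst Bochner_Integration.integral_add) (intro integrable_mult_right I | simp only: integral_mult_right_zero)+
      finally show ?thesis unfolding L2norm_sq .
    qed
    also have "?N ?r \<le> ?M * e"
      using weighted_bound(2)[OF chi' mr ir] mult_left_mono[OF r, of ?M] by simp
    finally have Np: "?N ?p \<le> (1 + d) * ?N v + (1 + 1 / d) * (?M * e)"
      using d by (simp add: mult_left_mono)
    have "(L2norm ?p)\<^sup>2 \<le> C * (?N ?p + (L2norm (weak_gradient ?p))\<^sup>2)"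
      by (rule obs[OF vproj_H_space[OF v K(1)] trig_poly_vproj[OF K]])
    also have "\<dots> \<le> C * (((1 + d) * ?N v + (1 + 1 / d) * (?M * e)) + ?D)"
      using C by (intro mult_left_mono add_mono Np weak_gradient_vproj_le[OF v K]) auto
    finally show ?thesis using le by (simp add: algebra_simps)
  qed
  \<comment> \<open>The order of limits matters: e tends to 0 first, with d fixed, because the
    coefficient of e contains 1 / d. Only then does d tend to 0.\<close>
  have "(L2norm v)\<^sup>2 \<le> C * (?N v + ?D) + (C * ?N v) * d" if d: "d > 0" for d
    using le_of_le_add_mult_epsilon[OF key[OF d]] by (simp add: algebra_simps)
  then show ?thesis by (rule le_of_le_add_mult_epsilon)
qed

theorem corollary4p4:
  fixes \<nu> K_min C_\<omega> :: real
    and \<omega> :: "(real^3) set"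
    and \<chi>_\<omega> :: "real^3 \<Rightarrow> real"
  assumes "\<nu> > 0" and "K_min \<ge> 0"
    and "torus_measurable_set \<omega>" and "torus_emeasure \<omega> > 0"
    and "\<chi>_\<omega> \<in> Linfty" and "AE x in T3. \<chi>_\<omega> x \<ge> 0"
    and "C_\<omega> > 0"
    and "\<And>v. v \<in> H_space \<Longrightarrow> trig_poly v \<Longrightarrow>
      (L2norm v)\<^sup>2 \<le>
        C_\<omega> * ((L2norm (\<lambda>x. sqrt (\<chi>_\<omega> x) *\<^sub>R v x))\<^sup>2 + (L2norm (weak_gradient v))\<^sup>2)"
  shows "(\<exists>\<alpha>_\<omega>>0. \<forall>v\<in>V_space.
            \<nu> * (L2norm (weak_gradient v))\<^sup>2
              + K_min * (L2norm (\<lambda>x. sqrt (\<chi>_\<omega> x) *\<^sub>R v x))\<^sup>2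
            \<ge> \<alpha>_\<omega> * (L2norm v)\<^sup>2)
       \<and> (\<forall>v\<in>V_space.
            \<nu> * (L2norm (weak_gradient v))\<^sup>2
              + K_min * (L2norm (\<lambda>x. sqrt (\<chi>_\<omega> x) *\<^sub>R v x))\<^sup>2
            \<ge> inverse C_\<omega> * min \<nu> K_min * (L2norm v)\<^sup>2)"
proof
  show "\<exists>\<alpha>_\<omega>>0. \<forall>v\<in>V_space.
            \<nu> * (L2norm (weak_gradient v))\<^sup>2
              + K_min * (L2norm (\<lambda>x. sqrt (\<chi>_\<omega> x) *\<^sub>R v x))\<^sup>2
            \<ge> \<alpha>_\<omega> * (L2norm v)\<^sup>2"
  \<comment> \<open>The explicit constant of the second claim is 0 when \<open>K_min = 0\<close>, so
    positivity is obtained from the Poincare inequality instead.\<close>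
  proof (intro exI[of _ \<nu>] conjI ballI)
    fix v assume "v \<in> V_space"
    then have "\<nu> * (L2norm v)\<^sup>2 \<le> \<nu> * (L2norm (weak_gradient v))\<^sup>2"
      using \<open>\<nu> > 0\<close> by (intro mult_left_mono poincare) auto
    moreover have "0 \<le> K_min * (L2norm (\<lambda>x. sqrt (\<chi>_\<omega> x) *\<^sub>R v x))\<^sup>2" using \<open>K_min \<ge> 0\<close> by simp
    ultimately show "\<nu> * (L2norm v)\<^sup>2 \<le> \<nu> * (L2norm (weak_gradient v))\<^sup>2
              + K_min * (L2norm (\<lambda>x. sqrt (\<chi>_\<omega> x) *\<^sub>R v x))\<^sup>2" by linarith
  qed (fact \<open>\<nu> > 0\<close>)
  show "\<forall>v\<in>V_space.
            \<nu> * (L2norm (weak_gradient v))\<^sup>2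
              + K_min * (L2norm (\<lambda>x. sqrt (\<chi>_\<omega> x) *\<^sub>R v x))\<^sup>2
            \<ge> inverse C_\<omega> * min \<nu> K_min * (L2norm v)\<^sup>2"
  proof
    fix v assume v: "v \<in> V_space"
    let ?N = "(L2norm (\<lambda>x. sqrt (\<chi>_\<omega> x) *\<^sub>R v x))\<^sup>2" and ?D = "(L2norm (weak_gradient v))\<^sup>2"
    let ?m = "min \<nu> K_min"
    have "(L2norm v)\<^sup>2 \<le> C_\<omega> * (?N + ?D)"
      by (rule observability_V_space[OF assms(5,6,7) assms(8) v])
    then have "inverse C_\<omega> * (L2norm v)\<^sup>2 \<le> ?N + ?D" using \<open>C_\<omega> > 0\<close> by (simp add: field_simps)
    \<comment> \<open>The observability inequality is scaled by the minimum, which is then replaced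
      by \<nu> in front of the gradient and by \<open>K_min\<close> in front of the weighted
      term.\<close>
    then have "?m * (inverse C_\<omega> * (L2norm v)\<^sup>2) \<le> ?m * (?N + ?D)"
      using \<open>\<nu> > 0\<close> \<open>K_min \<ge> 0\<close> by (intro mult_left_mono) auto
    also have "\<dots> = ?m * ?D + ?m * ?N" by (simp add: algebra_simps)
    also have "\<dots> \<le> \<nu> * ?D + K_min * ?N" by (intro add_mono mult_right_mono) auto
    finally show "inverse C_\<omega> * ?m * (L2norm v)\<^sup>2 \<le> \<nu> * ?D + K_min * ?N" by (simp add: algebra_simps)
  qed
qed

end
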